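(* Let $u$ be a solution of $$u_t=\Delta u+e^u \ \ (x\in\Omega,\ t>0),\qquad u=0\ \ (x\in\partial\Omega,\ t>0),\qquad u(x,0)=u_0(x)\ge 0\ \ (x\in\Omega),$$ that blows up with type I rate at $(x,t)=(0,T)$ for some $T<\infty$. Assume that $$\lim_{t\uparrow T}\bigl[\log(T-t)+u(y\sqrt{T-t},t)\bigr]=\varphi(y)$$ uniformly for $y$ in compact subsets of $\mathbb{R}^N$, where, for some $\alpha>0$ and $C_\alpha\in\mathbb{R}$, $\varphi$ satisfies $$\Delta\varphi-\frac{y}{2}\cdot\nabla\varphi+e^{\varphi}-1=0\quad(|y|>0),\qquad \varphi(0)=\alpha,\quad \nabla\varphi(0)=0,$$ and $$\lim_{|y|\to\infty}\bigl(\varphi(y)+2\log|y|\bigr)=C_\alpha .$$ Then the final time blow-up profile of $u$ is given by $$\bigl|u(x,T)+2\log|x|-C_\alpha\bigr|\to 0\quad\text{as }|x|\to 0 .$$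
   Context: Standing assumptions: $N$ is an integer with $3\le N\le 9$, $\Omega=B_R(0)=\{x\in\mathbb{R}^N:|x|<R\}$, and the initial function $u_0$ is nonnegative and belongs to $C^1(\overline\Omega)$. The solution $u$ is not assumed to be radially symmetric. Blow-up: $u$ blows up at $t=T\in(0,\infty)$ if $\|u(\cdot,t)\|_\infty<\infty$ for $t<T$ (so that $u$ is a classical solution on $(0,T)$) and $\limsup_{t\to T}\|u(\cdot,t)\|_\infty=\infty$. A point $x_0\in\Omega$ is a blow-up point if there are $(x_n,t_n)\in\Omega\times(0,T)$ with $(x_n,t_n)\to(x_0,T)$ and $u(x_n,t_n)\to\infty$. The blow-up is of type I if there are constants $C_1,C_2$ with $-C_1\le\log(T-t)+\|u(\cdot,t)\|_\infty\le C_2$ for $t<T$. "Blows up with type I rate at $(0,T)$" means that $u$ blows up at $t=T$, the blow-up is of type I, and $x=0$ is a blow-up point. For $x\neq0$ near $0$, $u(x,T)$ denotes $\lim_{t\uparrow T}u(x,t)$ (part of the assertion is that this limit exists for $x\ne 0$ close to $0$). *)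

theory Defs
  imports "HOL-Analysis.Analysis"
begin

definition gradient :: "('a::euclidean_space \<Rightarrow> real) \<Rightarrow> 'a \<Rightarrow> 'a" where
  "gradient f x = (THE D. GDERIV f x :> D)"

definition laplacian :: "('a::euclidean_space \<Rightarrow> real) \<Rightarrow> 'a \<Rightarrow> real" where
  "laplacian f x = (\<Sum>b\<in>Basis. (deriv ^^ 2) (\<lambda>s. f (x + s *\<^sub>R b)) 0)"

text \<open>The space \<open>C\<^sup>1\<close> of the closure of an open set \<open>S\<close>: the gradient in \<open>S\<close> extends
  continuously to the closure.\<close>
definition C1_closure :: "'a::euclidean_space set \<Rightarrow> ('a \<Rightarrow> real) \<Rightarrow> bool" where
  "C1_closure S f \<longleftrightarrow>
     continuous_on (closure S) f \<and>
     (\<exists>g. continuous_on (closure S) g \<and> (\<forall>x\<in>S. GDERIV f x :> g x))"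

text \<open>Here \<open>S\<close> is meant to be open; \<open>H\<close> is the Hessian, as a linear-operator-valued map.\<close>
definition C2_on :: "'a::euclidean_space set \<Rightarrow> ('a \<Rightarrow> real) \<Rightarrow> bool" where
  "C2_on S f \<longleftrightarrow>
     (\<exists>g (H :: 'a \<Rightarrow> 'a \<Rightarrow>\<^sub>L 'a).
        continuous_on S H \<and>
        (\<forall>x\<in>S. GDERIV f x :> g x \<and> (g has_derivative blinfun_apply (H x)) (at x)))"

text \<open>The parabolic class \<open>C\<^sup>2\<^sup>,\<^sup>1\<close> on an open set \<open>Q\<close> of pairs (space, time): the first and second
  space derivatives and the first time derivative exist and are jointly continuous.\<close>
definition C21_on :: "('a::euclidean_space \<times> real) set \<Rightarrow> ('a \<Rightarrow> real \<Rightarrow> real) \<Rightarrow> bool" where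
  "C21_on Q u \<longleftrightarrow>
     (\<exists>(g :: 'a \<times> real \<Rightarrow> 'a) (H :: 'a \<times> real \<Rightarrow> 'a \<Rightarrow>\<^sub>L 'a) (v :: 'a \<times> real \<Rightarrow> real).
        continuous_on Q g \<and> continuous_on Q H \<and> continuous_on Q v \<and>
        (\<forall>(x, t)\<in>Q.
           GDERIV (\<lambda>z. u z t) x :> g (x, t) \<and>
           ((\<lambda>z. g (z, t)) has_derivative blinfun_apply (H (x, t))) (at x) \<and>
           (u x has_real_derivative v (x, t)) (at t)))"

text \<open>Classical solutions on the time interval \<open>(0, T)\<close>. The initial function need not vanish on
  the boundary, so continuity is not required at the points of \<open>frontier \<Omega> \<times> {0}\<close>.\<close>
definition classical_solution ::
  "'a::euclidean_space set \<Rightarrow> ('a \<Rightarrow> real) \<Rightarrow> real \<Rightarrow> ('a \<Rightarrow> real \<Rightarrow> real) \<Rightarrow> bool" where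
  "classical_solution \<Omega> u0 T u \<longleftrightarrow>
     C21_on (\<Omega> \<times> {0<..<T}) u \<and>
     continuous_on (closure \<Omega> \<times> {0..<T} - frontier \<Omega> \<times> {0}) (\<lambda>(x, t). u x t) \<and>
     (\<forall>x\<in>\<Omega>. \<forall>t\<in>{0<..<T}. deriv (u x) t = laplacian (\<lambda>z. u z t) x + exp (u x t)) \<and>
     (\<forall>x\<in>frontier \<Omega>. \<forall>t\<in>{0<..<T}. u x t = 0) \<and>
     (\<forall>x\<in>\<Omega>. u x 0 = u0 x)"

text \<open>The supremum is taken in the extended reals, so that an unbounded function has norm \<open>\<infinity>\<close>.\<close>
definition sup_norm :: "'a set \<Rightarrow> ('a \<Rightarrow> real) \<Rightarrow> ereal" where
  "sup_norm S f = (SUP x\<in>S. ereal \<bar>f x\<bar>)"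

definition blows_up_at :: "'a set \<Rightarrow> ('a \<Rightarrow> real \<Rightarrow> real) \<Rightarrow> real \<Rightarrow> bool" where
  "blows_up_at \<Omega> u T \<longleftrightarrow>
     0 < T \<and>
     (\<forall>t\<in>{0..<T}. sup_norm \<Omega> (\<lambda>x. u x t) < \<infinity>) \<and>
     Limsup (at_left T) (\<lambda>t. sup_norm \<Omega> (\<lambda>x. u x t)) = \<infinity>"

definition blow_up_point ::
  "'a::euclidean_space set \<Rightarrow> ('a \<Rightarrow> real \<Rightarrow> real) \<Rightarrow> real \<Rightarrow> 'a \<Rightarrow> bool" where
  "blow_up_point \<Omega> u T x0 \<longleftrightarrow>
     x0 \<in> \<Omega> \<and>
     (\<exists>(X :: nat \<Rightarrow> 'a) (\<tau> :: nat \<Rightarrow> real).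
        (\<forall>n. X n \<in> \<Omega> \<and> \<tau> n \<in> {0<..<T}) \<and>
        X \<longlonglongrightarrow> x0 \<and> \<tau> \<longlonglongrightarrow> T \<and>
        filterlim (\<lambda>n. u (X n) (\<tau> n)) at_top sequentially)"

definition type_I_rate :: "'a set \<Rightarrow> ('a \<Rightarrow> real \<Rightarrow> real) \<Rightarrow> real \<Rightarrow> bool" where
  "type_I_rate \<Omega> u T \<longleftrightarrow>
     (\<exists>C1 C2 :: real. \<forall>t\<in>{0..<T}.
        ereal (- C1) \<le> ereal (ln (T - t)) + sup_norm \<Omega> (\<lambda>x. u x t) \<and>
        ereal (ln (T - t)) + sup_norm \<Omega> (\<lambda>x. u x t) \<le> ereal C2)"

definition type_I_blow_up_at ::
  "'a::euclidean_space set \<Rightarrow> ('a \<Rightarrow> real \<Rightarrow> real) \<Rightarrow> 'a \<Rightarrow> real \<Rightarrow> bool" where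
  "type_I_blow_up_at \<Omega> u x0 T \<longleftrightarrow>
     blows_up_at \<Omega> u T \<and> type_I_rate \<Omega> u T \<and> blow_up_point \<Omega> u T x0"

text \<open>The value \<open>u(x, T)\<close>; meaningful only where the limit exists.\<close>
definition final_profile :: "('a \<Rightarrow> real \<Rightarrow> real) \<Rightarrow> real \<Rightarrow> 'a \<Rightarrow> real" where
  "final_profile u T x = Lim (at_left T) (u x)"

end

theory Submission
  imports Defs
begin

text \<open>Write \<open>\<tau> = T - t\<close>. The convergence of the rescaled solution and the behaviour of \<open>\<phi>\<close> at
  infinity say that \<open>u\<close> is close to \<open>C - 2 ln \<bar>x\<bar>\<close> on each shell
  \<open>K0 \<surd>\<tau> \<le> \<bar>x\<bar> \<le> K \<surd>\<tau>\<close> once \<open>t\<close> is close to \<open>T\<close> (\<open>profile_on_shells\<close>). A fixed point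
  \<open>x \<noteq> 0\<close> lies on the sphere \<open>\<bar>x\<bar> = K \<surd>\<tau>\<close> at the time \<open>T - \<bar>x\<bar>\<^sup>2 / K\<^sup>2\<close> only. The remaining time is a
  fraction \<open>1 / K\<^sup>2\<close> of the diffusive time scale \<open>\<bar>x\<bar>\<^sup>2\<close> of this point, so the profile should move by
  only \<open>O(1 / K\<^sup>2)\<close> until \<open>T\<close>, and \<open>K\<close> may be taken as large as desired.

  Two things could spoil this: the source \<open>exp u\<close>, about which the type I rate says no more
  than \<open>exp u \<le> M / \<tau>\<close>, and the influence of points away from \<open>0\<close>, where \<open>u\<close> may even blow up.
  The first is handled by \<open>type_I_local_upper_bound\<close>: a solution that is moderate on a ball of
  radius comparable to \<open>l\<close> and has the type I rate there stays moderate at the centre for a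
  time \<open>\<theta> l\<^sup>2\<close>. Applied at all scales \<open>l = \<bar>x\<bar>\<close> it gives \<open>exp u \<le> A0 / \<bar>x\<bar>\<^sup>2\<close>, a source of the same
  order as the Laplacian of \<open>ln \<bar>x\<bar>\<close>. The second is handled by
  \<open>paraboloid_exterior_upper_bound\<close>, which compares \<open>u\<close> and \<open>- u\<close> on \<open>K\<^sup>2 \<tau> \<le> \<bar>x\<bar>\<^sup>2 \<le> r\<^sup>2\<close> with an
  explicit barrier; the values on \<open>\<bar>x\<bar> = r\<close> contribute a term \<open>\<Lambda> \<bar>x\<bar>\<^sup>2\<close> that disappears as
  \<open>x \<rightarrow> 0\<close>, however large \<open>\<Lambda>\<close> is. Together they give \<open>profile_estimate\<close>.

  The limit \<open>u(x, T)\<close> exists because \<open>u\<close> and \<open>exp u\<close> are then bounded near \<open>(x, T)\<close>: a bounded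
  solution with bounded source is Lipschitz in space (\<open>heat_interior_lipschitz\<close>, by comparing it
  with its reflections), and a spatial modulus of continuity yields one in time
  (\<open>heat_upper_bound_forward_in_time\<close>). All estimates come from one comparison principle,
  \<open>heat_comparison\<close>, applied to barriers whose derivatives can be written down.\<close>

section \<open>Second derivatives and the Laplacian as relations\<close>

text \<open>The first derivative is required in a neighbourhood, which is what the second derivative
  test at a maximum needs. A relation, unlike iterated \<open>deriv\<close>, obeys sum and scaling rules without
  differentiability side conditions.\<close>
definition has_second_deriv :: "(real \<Rightarrow> real) \<Rightarrow> real \<Rightarrow> bool" where
  "has_second_deriv \<phi> D \<longleftrightarrow>
     (\<exists>g. (\<forall>\<^sub>F s in nhds 0. (\<phi> has_real_derivative g s) (at s)) \<and>
          (g has_real_derivative D) (at 0))"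

lemma has_second_derivI:
  "\<forall>\<^sub>F s in nhds 0. (\<phi> has_real_derivative g s) (at s) \<Longrightarrow>
   (g has_real_derivative D) (at 0) \<Longrightarrow> has_second_deriv \<phi> D"
  unfolding has_second_deriv_def by blast

lemma has_second_deriv_add:
  assumes "has_second_deriv \<phi> D" "has_second_deriv \<psi> E"
  shows "has_second_deriv (\<lambda>s. \<phi> s + \<psi> s) (D + E)"
proof -
  obtain g h where
    g: "\<forall>\<^sub>F s in nhds 0. (\<phi> has_real_derivative g s) (at s)" "(g has_real_derivative D) (at 0)" and
    h: "\<forall>\<^sub>F s in nhds 0. (\<psi> has_real_derivative h s) (at s)" "(h has_real_derivative E) (at 0)"
    using assms unfolding has_second_deriv_def by blast
  have "\<forall>\<^sub>F s in nhds 0. ((\<lambda>s. \<phi> s + \<psi> s) has_real_derivative g s + h s) (at s)"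
    using g(1) h(1) by eventually_elim (rule DERIV_add)
  then show ?thesis
    by (rule has_second_derivI[OF _ DERIV_add[OF g(2) h(2)]])
qed

lemma has_second_deriv_cmult:
  assumes "has_second_deriv \<phi> D"
  shows "has_second_deriv (\<lambda>s. c * \<phi> s) (c * D)"
proof -
  obtain g where
    g: "\<forall>\<^sub>F s in nhds 0. (\<phi> has_real_derivative g s) (at s)" "(g has_real_derivative D) (at 0)"
    using assms unfolding has_second_deriv_def by blast
  have "\<forall>\<^sub>F s in nhds 0. ((\<lambda>s. c * \<phi> s) has_real_derivative c * g s) (at s)"
    using g(1) by eventually_elim (rule DERIV_cmult)
  then show ?thesis
    by (rule has_second_derivI[OF _ DERIV_cmult[OF g(2)]])
qed

lemma has_second_deriv_const: "has_second_deriv (\<lambda>_. c) 0"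
  unfolding has_second_deriv_def by (intro exI[of _ "\<lambda>_. 0"]) auto

lemma has_second_deriv_reflect:
  assumes "has_second_deriv \<phi> D"
  shows "has_second_deriv (\<lambda>s. \<phi> (- s)) D"
proof -
  obtain g where
    g: "\<forall>\<^sub>F s in nhds 0. (\<phi> has_real_derivative g s) (at s)" "(g has_real_derivative D) (at 0)"
    using assms unfolding has_second_deriv_def by blast
  have lim: "filterlim (\<lambda>s::real. - s) (nhds 0) (nhds 0)"
    using tendsto_minus[OF filterlim_ident[of "nhds (0::real)"]] by simp
  have "\<forall>\<^sub>F s in nhds 0. (\<phi> has_real_derivative g (- s)) (at (- s))"
    using lim g(1) unfolding filterlim_iff by blast
  then have "\<forall>\<^sub>F s in nhds 0. ((\<lambda>s. \<phi> (- s)) has_real_derivative - g (- s)) (at s)"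
    by eventually_elim (simp add: DERIV_mirror)
  moreover have "((\<lambda>s. - g (- s)) has_real_derivative D) (at 0)"
    using DERIV_minus[OF iffD1[OF DERIV_mirror, of g D 0]] g(2) by simp
  ultimately show ?thesis
    by (rule has_second_derivI)
qed

lemma has_second_deriv_compose:
  fixes G \<gamma> :: "real \<Rightarrow> real"
  assumes G: "\<forall>\<^sub>F r in nhds (\<gamma> 0). (G has_real_derivative G1 r) (at r)"
      "(G1 has_real_derivative G2) (at (\<gamma> 0))"
    and \<gamma>: "\<And>s. (\<gamma> has_real_derivative d\<gamma> s) (at s)" "(d\<gamma> has_real_derivative dd\<gamma>) (at 0)"
  shows "has_second_deriv (\<lambda>s. G (\<gamma> s)) (G2 * (d\<gamma> 0)\<^sup>2 + G1 (\<gamma> 0) * dd\<gamma>)"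
proof -
  have "isCont \<gamma> 0"
    using \<gamma>(1) DERIV_isCont by blast
  then have "filterlim \<gamma> (nhds (\<gamma> 0)) (nhds 0)"
    unfolding isCont_def tendsto_at_iff_tendsto_nhds .
  then have "\<forall>\<^sub>F s in nhds 0. (G has_real_derivative G1 (\<gamma> s)) (at (\<gamma> s))"
    using G(1) unfolding filterlim_iff by blast
  then have "\<forall>\<^sub>F s in nhds 0. ((\<lambda>s. G (\<gamma> s)) has_real_derivative G1 (\<gamma> s) * d\<gamma> s) (at s)"
    by eventually_elim (rule DERIV_chain2[OF _ \<gamma>(1)])
  moreover have "((\<lambda>s. G1 (\<gamma> s) * d\<gamma> s) has_real_derivative
      G2 * (d\<gamma> 0)\<^sup>2 + G1 (\<gamma> 0) * dd\<gamma>) (at 0)"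
    using DERIV_mult[OF DERIV_chain2[OF G(2) \<gamma>(1)] \<gamma>(2)]
    by (simp add: power2_eq_square algebra_simps)
  ultimately show ?thesis
    by (rule has_second_derivI)
qed

lemma has_second_deriv_max_nonpos:
  assumes D: "has_second_deriv \<phi> D"
    and max: "\<forall>\<^sub>F s in nhds 0. \<phi> s \<le> \<phi> 0"
  shows "D \<le> 0"
proof (rule ccontr)
  assume "\<not> D \<le> 0"
  obtain g where
    g: "\<forall>\<^sub>F s in nhds 0. (\<phi> has_real_derivative g s) (at s)" "(g has_real_derivative D) (at 0)"
    using D unfolding has_second_deriv_def by blast
  obtain d1 where d1: "d1 > 0"
      "\<And>s. \<bar>s\<bar> < d1 \<Longrightarrow> (\<phi> has_real_derivative g s) (at s)"
      "\<And>s. \<bar>s\<bar> < d1 \<Longrightarrow> \<phi> s \<le> \<phi> 0"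
    using eventually_conj[OF g(1) max] unfolding eventually_nhds_metric dist_real_def by auto
  have "g 0 = 0"
    using d1 by (intro DERIV_local_max[of \<phi> _ 0 d1]) auto
  then obtain d2 where d2: "d2 > 0" "\<And>s. 0 < s \<Longrightarrow> s < d2 \<Longrightarrow> 0 < g s"
    using has_real_derivative_pos_inc_right[OF g(2), of] \<open>\<not> D \<le> 0\<close> by auto
  define e where "e = min d1 d2 / 2"
  have e: "0 < e" "e < d1" "e < d2"
    using d1(1) d2(1) unfolding e_def by auto
  have "\<phi> 0 < \<phi> e"
  proof (rule DERIV_pos_imp_increasing_open[OF e(1)])
    show "\<exists>y. (\<phi> has_real_derivative y) (at s) \<and> 0 < y" if "0 < s" "s < e" for s
      using d1(2)[of s] d2(2)[of s] that e by auto
    show "continuous_on {0..e} \<phi>"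
      using d1(2) e by (intro continuous_at_imp_continuous_on) (metis DERIV_isCont abs_of_nonneg
          atLeastAtMost_iff le_less_trans)
  qed
  with d1(3)[of e] e show False by simp
qed

definition has_laplacian :: "('a::euclidean_space \<Rightarrow> real) \<Rightarrow> real \<Rightarrow> 'a \<Rightarrow> bool" where
  "has_laplacian f L x \<longleftrightarrow>
     (\<exists>h. (\<forall>b\<in>Basis. has_second_deriv (\<lambda>s. f (x + s *\<^sub>R b)) (h b)) \<and> L = (\<Sum>b\<in>Basis. h b))"

lemma has_laplacian_add:
  assumes "has_laplacian f L x" "has_laplacian g M x"
  shows "has_laplacian (\<lambda>z. f z + g z) (L + M) x"
proof -
  obtain h k where
    "\<forall>b\<in>Basis. has_second_deriv (\<lambda>s. f (x + s *\<^sub>R b)) (h b)" "L = sum h Basis"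
    "\<forall>b\<in>Basis. has_second_deriv (\<lambda>s. g (x + s *\<^sub>R b)) (k b)" "M = sum k Basis"
    using assms unfolding has_laplacian_def by blast
  then show ?thesis
    unfolding has_laplacian_def
    by (intro exI[of _ "\<lambda>b. h b + k b"]) (auto intro: has_second_deriv_add simp: sum.distrib)
qed

lemma has_laplacian_cmult:
  assumes "has_laplacian f L x"
  shows "has_laplacian (\<lambda>z. c * f z) (c * L) x"
proof -
  obtain h where
    "\<forall>b\<in>Basis. has_second_deriv (\<lambda>s. f (x + s *\<^sub>R b)) (h b)" "L = sum h Basis"
    using assms unfolding has_laplacian_def by blast
  then show ?thesis
    unfolding has_laplacian_def
    by (intro exI[of _ "\<lambda>b. c * h b"]) (auto intro: has_second_deriv_cmult simp: sum_distrib_left)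
qed

lemma has_laplacian_minus:
  assumes "has_laplacian f L x"
  shows "has_laplacian (\<lambda>z. - f z) (- L) x"
  using has_laplacian_cmult[OF assms, of "- 1"] by simp

lemma has_laplacian_diff:
  assumes "has_laplacian f L x" "has_laplacian g M x"
  shows "has_laplacian (\<lambda>z. f z - g z) (L - M) x"
  using has_laplacian_add[OF assms(1) has_laplacian_minus[OF assms(2)]] by simp

lemma has_laplacian_const: "has_laplacian (\<lambda>_. c) 0 x"
  unfolding has_laplacian_def
  by (intro exI[of _ "\<lambda>_. 0"]) (auto intro: has_second_deriv_const)

text \<open>All barriers below are combinations of functions of the distance to a point and, for the
  reflection argument, of a single coordinate; this rule and the next one differentiate them.\<close>
lemma has_laplacian_radial:
  fixes x p :: "'a::euclidean_space"
  assumes "\<forall>\<^sub>F r in nhds ((norm (x - p))\<^sup>2). (G has_real_derivative G1 r) (at r)"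
    and "(G1 has_real_derivative G2) (at ((norm (x - p))\<^sup>2))"
  shows "has_laplacian (\<lambda>z. G ((norm (z - p))\<^sup>2))
           (2 * real DIM('a) * G1 ((norm (x - p))\<^sup>2) + 4 * (norm (x - p))\<^sup>2 * G2) x"
proof -
  let ?\<rho> = "(norm (x - p))\<^sup>2"
  have "has_second_deriv (\<lambda>s. G ((norm (x + s *\<^sub>R b - p))\<^sup>2))
      (G2 * (2 * ((x - p) \<bullet> b))\<^sup>2 + G1 ?\<rho> * 2)" if "b \<in> Basis" for b
  proof -
    let ?\<gamma> = "\<lambda>s. ?\<rho> + 2 * ((x - p) \<bullet> b) * s + s\<^sup>2"
    have sq: "(norm (x + s *\<^sub>R b - p))\<^sup>2 = ?\<gamma> s" for s
    proof -
      have "(norm (x + s *\<^sub>R b - p))\<^sup>2 = ((x - p) + s *\<^sub>R b) \<bullet> ((x - p) + s *\<^sub>R b)"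
        by (simp add: power2_norm_eq_inner algebra_simps)
      also have "\<dots> = ?\<rho> + 2 * s * ((x - p) \<bullet> b) + s\<^sup>2 * (b \<bullet> b)"
        by (simp only: inner_add_left inner_add_right inner_scaleR_left inner_scaleR_right
            power2_norm_eq_inner inner_commute[of b "x - p"]) (simp add: power2_eq_square algebra_simps)
      finally show ?thesis using that by (simp add: algebra_simps)
    qed
    have "has_second_deriv (\<lambda>s. G (?\<gamma> s)) (G2 * (2 * ((x - p) \<bullet> b) + 2 * 0)\<^sup>2 + G1 (?\<gamma> 0) * 2)"
      by (rule has_second_deriv_compose[where d\<gamma> = "\<lambda>s. 2 * ((x - p) \<bullet> b) + 2 * s"])
         (use assms in \<open>auto intro!: derivative_eq_intros\<close>)
    then show ?thesis unfolding sq by simp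
  qed
  moreover have "2 * real DIM('a) * G1 ?\<rho> + 4 * ?\<rho> * G2 =
      (\<Sum>b\<in>Basis. G2 * (2 * ((x - p) \<bullet> b))\<^sup>2 + G1 ?\<rho> * 2)"
  proof -
    have pythagoras: "?\<rho> = (\<Sum>b\<in>Basis. ((x - p) \<bullet> b)\<^sup>2)"
      unfolding power2_norm_eq_inner by (subst euclidean_inner) (simp add: power2_eq_square)
    have "(\<Sum>b\<in>(Basis::'a set). G2 * (2 * c b)\<^sup>2 + G1 ?\<rho> * 2) =
        4 * G2 * (\<Sum>b\<in>Basis. (c b)\<^sup>2) + 2 * real DIM('a) * G1 ?\<rho>" for c
      by (simp add: sum.distrib power_mult_distrib sum_distrib_left mult_ac)
    from this[of "\<lambda>b. (x - p) \<bullet> b", folded pythagoras] show ?thesis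
      by simp
  qed
  ultimately show ?thesis
    unfolding has_laplacian_def
    by (intro exI[of _ "\<lambda>b. G2 * (2 * ((x - p) \<bullet> b))\<^sup>2 + G1 ?\<rho> * 2"]) auto
qed

lemma has_laplacian_coordinate:
  fixes x p b0 :: "'a::euclidean_space"
  assumes b0: "b0 \<in> Basis"
    and G: "\<forall>\<^sub>F r in nhds ((x - p) \<bullet> b0). (G has_real_derivative G1 r) (at r)"
      "(G1 has_real_derivative G2) (at ((x - p) \<bullet> b0))"
  shows "has_laplacian (\<lambda>z. G ((z - p) \<bullet> b0)) G2 x"
proof -
  have "has_second_deriv (\<lambda>s. G ((x + s *\<^sub>R b - p) \<bullet> b0)) (G2 * (b \<bullet> b0)\<^sup>2)" for b
  proof -
    let ?\<gamma> = "\<lambda>s. (x - p) \<bullet> b0 + (b \<bullet> b0) * s"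
    have eq: "(x + s *\<^sub>R b - p) \<bullet> b0 = ?\<gamma> s" for s
      by (simp add: inner_simps algebra_simps)
    have "has_second_deriv (\<lambda>s. G (?\<gamma> s)) (G2 * (b \<bullet> b0)\<^sup>2 + G1 (?\<gamma> 0) * 0)"
      by (rule has_second_deriv_compose[where d\<gamma> = "\<lambda>s. b \<bullet> b0"])
         (use G in \<open>auto intro!: derivative_eq_intros\<close>)
    then show ?thesis unfolding eq by simp
  qed
  moreover have "G2 = (\<Sum>b\<in>Basis. G2 * (b \<bullet> b0)\<^sup>2)"
  proof -
    have "(\<Sum>b\<in>Basis. G2 * (b \<bullet> b0)\<^sup>2) = (\<Sum>b\<in>Basis. if b = b0 then G2 else 0)"
      using b0 by (intro sum.cong) (auto simp: inner_Basis)
    then show ?thesis using b0 by simp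
  qed
  ultimately show ?thesis
    unfolding has_laplacian_def by (intro exI[of _ "\<lambda>b. G2 * (b \<bullet> b0)\<^sup>2"]) auto
qed

text \<open>The reflection in the hyperplane through \<open>q\<close> orthogonal to the unit vector \<open>b\<close>. For
  \<open>b \<in> Basis\<close> it maps every coordinate direction to itself or its opposite, so that the
  Laplacian, a sum over \<open>Basis\<close>, is visibly invariant.\<close>
definition reflect :: "'a::euclidean_space \<Rightarrow> 'a \<Rightarrow> 'a \<Rightarrow> 'a" where
  "reflect q b x = x - (2 * ((x - q) \<bullet> b)) *\<^sub>R b"

lemma has_laplacian_reflect:
  fixes f :: "'a::euclidean_space \<Rightarrow> real"
  assumes b: "b \<in> Basis" and L: "has_laplacian f L (reflect q b x)"
  shows "has_laplacian (\<lambda>z. f (reflect q b z)) L x"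
proof -
  obtain h where
    h: "\<And>c. c \<in> Basis \<Longrightarrow> has_second_deriv (\<lambda>s. f (reflect q b x + s *\<^sub>R c)) (h c)"
      "L = sum h Basis"
    using L unfolding has_laplacian_def by blast
  have "has_second_deriv (\<lambda>s. f (reflect q b (x + s *\<^sub>R c))) (h c)" if c: "c \<in> Basis" for c
  proof (cases "c = b")
    case True
    have "reflect q b (x + s *\<^sub>R c) = reflect q b x + (- s) *\<^sub>R c" for s
    proof -
      have "(x + s *\<^sub>R c - q) \<bullet> b = (x - q) \<bullet> b + s"
        using b True by (simp add: inner_diff_left inner_add_left)
      then have "2 * ((x + s *\<^sub>R c - q) \<bullet> b) = 2 * ((x - q) \<bullet> b) + s + s"
        by simp
      then show ?thesis
        unfolding reflect_def True by (simp only: scaleR_add_left) simp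
    qed
    then show ?thesis
      using has_second_deriv_reflect[OF h(1)[OF c]] by simp
  next
    case False
    then have "c \<bullet> b = 0" using b c by (simp add: inner_Basis)
    then have "reflect q b (x + s *\<^sub>R c) = reflect q b x + s *\<^sub>R c" for s
      by (simp add: reflect_def inner_simps)
    then show ?thesis
      using h(1)[OF c] by simp
  qed
  with h(2) show ?thesis unfolding has_laplacian_def by blast
qed

lemma has_laplacian_max_nonpos:
  fixes f :: "'a::euclidean_space \<Rightarrow> real"
  assumes L: "has_laplacian f L x" and d: "d > 0"
    and max: "\<And>z. dist z x < d \<Longrightarrow> f z \<le> f x"
  shows "L \<le> 0"
proof -
  obtain h where
    h: "\<And>b. b \<in> Basis \<Longrightarrow> has_second_deriv (\<lambda>s. f (x + s *\<^sub>R b)) (h b)" "L = sum h Basis"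
    using L unfolding has_laplacian_def by blast
  have "h b \<le> 0" if b: "b \<in> Basis" for b
  proof (rule has_second_deriv_max_nonpos[OF h(1)[OF b]])
    show "\<forall>\<^sub>F s in nhds 0. f (x + s *\<^sub>R b) \<le> f (x + 0 *\<^sub>R b)"
      unfolding eventually_nhds_metric
      using d max b by (intro exI[of _ d]) (auto simp: dist_norm)
  qed
  with h(2) show ?thesis by (simp add: sum_nonpos)
qed

section \<open>Comparison with strict barriers\<close>

text \<open>Interior up to the final time: the points near \<open>x\<close> at time \<open>t\<close> and the recent past of \<open>x\<close>,
  which are all that a first touching argument looks at.\<close>
definition parabolic_interior :: "('a::metric_space \<times> real) set \<Rightarrow> 'a \<Rightarrow> real \<Rightarrow> bool" where
  "parabolic_interior S x t \<longleftrightarrow>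
     (\<exists>d>0. (\<forall>z. dist z x < d \<longrightarrow> (z, t) \<in> S) \<and> (\<forall>s. t - d < s \<and> s \<le> t \<longrightarrow> (x, s) \<in> S))"

text \<open>At the first time at which \<open>w\<close> reaches \<open>0\<close>, the point where this happens maximises \<open>w\<close> at that
  time and \<open>w\<close> was negative before; so its Laplacian is nonpositive and its time derivative
  nonnegative, against the strict inequality assumed at touching points. As the inequality is
  asked for at touching points only, nonlinear source terms may be evaluated on the barrier.\<close>
lemma no_touching_imp_negative:
  fixes w :: "'a::euclidean_space \<Rightarrow> real \<Rightarrow> real"
  assumes S: "compact S" and cont: "continuous_on S (\<lambda>(x, t). w x t)"
    and interior: "\<And>x t. (x, t) \<in> S \<Longrightarrow> 0 \<le> w x t \<Longrightarrow> parabolic_interior S x t"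
    and touch: "\<And>x t. (x, t) \<in> S \<Longrightarrow> w x t = 0 \<Longrightarrow>
      \<exists>wt L. (w x has_real_derivative wt) (at t) \<and> has_laplacian (\<lambda>z. w z t) L x \<and> wt < L"
    and xt: "(x, t) \<in> S"
  shows "w x t < 0"
proof (rule ccontr)
  assume "\<not> w x t < 0"
  define Z where "Z = {P \<in> S. 0 \<le> (\<lambda>(x, t). w x t) P}"
  have "closedin (top_of_set S) (S \<inter> (\<lambda>(x, t). w x t) -` {0..})"
    using cont by (rule continuous_closedin_preimage) simp
  moreover have "S \<inter> (\<lambda>(x, t). w x t) -` {0..} = Z"
    unfolding Z_def by auto
  ultimately have "compact Z"
    using S closedin_compact by auto
  moreover have "Z \<noteq> {}"
    using xt \<open>\<not> w x t < 0\<close> unfolding Z_def by force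
  ultimately obtain P where P: "P \<in> Z" "\<And>P'. P' \<in> Z \<Longrightarrow> snd P \<le> snd P'"
    using continuous_attains_inf[of Z snd] continuous_on_snd[OF continuous_on_id] by blast
  obtain y s where ys: "P = (y, s)" by (cases P)
  have yS: "(y, s) \<in> S" "0 \<le> w y s"
    using P(1) unfolding Z_def ys by auto
  have before: "w z r < 0" if "(z, r) \<in> S" "r < s" for z r
    using P(2)[of "(z, r)"] that unfolding Z_def ys by force
  \<comment> \<open>At the first touching time nothing can be positive yet, by continuity in time.\<close>
  have now: "w z s \<le> 0" if zS: "(z, s) \<in> S" for z
  proof (rule ccontr)
    assume "\<not> w z s \<le> 0"
    then obtain d where d: "d > 0" "\<And>r. s - d < r \<Longrightarrow> r \<le> s \<Longrightarrow> (z, r) \<in> S"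
      using interior[OF zS] unfolding parabolic_interior_def by auto
    have "continuous_on {s - d<..s} (\<lambda>r. (\<lambda>(x, t). w x t) (z, r))"
      using d(2) by (intro continuous_on_compose2[OF cont]) (auto intro!: continuous_intros)
    then have "((\<lambda>r. w z r) \<longlongrightarrow> w z s) (at s within {s - d<..s})"
      using d(1) unfolding continuous_on_def by auto
    then have "\<forall>\<^sub>F r in at s within {s - d<..s}. 0 < w z r"
      using \<open>\<not> w z s \<le> 0\<close> order_tendstoD(1) by (metis not_le)
    then obtain e where e: "e > 0"
        "\<And>r. r \<in> {s - d<..s} \<Longrightarrow> r \<noteq> s \<Longrightarrow> dist r s < e \<Longrightarrow> 0 < w z r"
      unfolding eventually_at by blast
    define r where "r = s - min d e / 2"
    have r: "s - d < r" "r < s" "dist r s < e"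
      using d(1) e(1) unfolding r_def dist_real_def by auto
    then show False
      using e(2)[of r] before[of z r] d(2)[of r] by force
  qed
  have zero: "w y s = 0"
    using now[OF yS(1)] yS(2) by simp
  obtain wt L where der: "(w y has_real_derivative wt) (at s)"
    "has_laplacian (\<lambda>z. w z s) L y" "wt < L"
    using touch[OF yS(1) zero] by blast
  obtain d where d: "d > 0" "\<And>z. dist z y < d \<Longrightarrow> (z, s) \<in> S"
      "\<And>r. s - d < r \<Longrightarrow> r \<le> s \<Longrightarrow> (y, r) \<in> S"
    using interior[OF yS] unfolding parabolic_interior_def by blast
  have "L \<le> 0"
    by (rule has_laplacian_max_nonpos[OF der(2) d(1)]) (simp add: zero now d(2))
  have "0 \<le> wt"
  proof (rule ccontr)
    assume "\<not> 0 \<le> wt"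
    then obtain e where e: "e > 0" "\<And>h. 0 < h \<Longrightarrow> h < e \<Longrightarrow> w y s < w y (s - h)"
      using DERIV_neg_dec_left[OF der(1)] by auto
    define h where "h = min d e / 2"
    have "0 < h" "h < d" "h < e"
      using d(1) e(1) unfolding h_def by auto
    then show False
      using e(2)[of h] before[of y "s - h"] d(3)[of "s - h"] zero by force
  qed
  with \<open>L \<le> 0\<close> der(3) show False by simp
qed

text \<open>The source \<open>f\<close> is a function of space and time, so that the nonlinear equation
  (\<open>f x t = exp (u x t)\<close>), its negative and differences of solutions are all covered.\<close>
definition solves_heat ::
  "('a::euclidean_space \<times> real) set \<Rightarrow> ('a \<Rightarrow> real \<Rightarrow> real) \<Rightarrow> ('a \<Rightarrow> real \<Rightarrow> real) \<Rightarrow> bool" where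
  "solves_heat Q u f \<longleftrightarrow>
     continuous_on Q (\<lambda>(x, t). u x t) \<and>
     (\<forall>(x, t)\<in>Q. \<exists>L. (u x has_real_derivative (L + f x t)) (at t) \<and>
                      has_laplacian (\<lambda>z. u z t) L x)"

lemma solves_heat_subset: "solves_heat Q u f \<Longrightarrow> S \<subseteq> Q \<Longrightarrow> solves_heat S u f"
  unfolding solves_heat_def by (blast intro: continuous_on_subset)

lemma solves_heat_minus:
  assumes "solves_heat Q u f"
  shows "solves_heat Q (\<lambda>x t. - u x t) (\<lambda>x t. - f x t)"
  unfolding solves_heat_def
proof (intro conjI ballI; clarify?)
  show "continuous_on Q (\<lambda>(x, t). - u x t)"
    using assms continuous_on_minus[of Q "\<lambda>(x, t). u x t"]
    unfolding solves_heat_def by (simp add: case_prod_unfold)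
  fix x t assume "(x, t) \<in> Q"
  then obtain L where "(u x has_real_derivative (L + f x t)) (at t)" "has_laplacian (\<lambda>z. u z t) L x"
    using assms unfolding solves_heat_def by blast
  then show "\<exists>L. ((\<lambda>t. - u x t) has_real_derivative (L + - f x t)) (at t) \<and>
      has_laplacian (\<lambda>z. - u z t) L x"
    by (intro exI[of _ "- L"]) (auto intro: has_laplacian_minus dest: DERIV_minus)
qed

lemma heat_comparison:
  fixes u U f :: "'a::euclidean_space \<Rightarrow> real \<Rightarrow> real"
  assumes S: "compact S" and u: "solves_heat S u f"
    and U: "continuous_on S (\<lambda>(x, t). U x t)"
    and boundary: "\<And>x t. (x, t) \<in> S \<Longrightarrow> \<not> parabolic_interior S x t \<Longrightarrow> u x t < U x t"
    and strict: "\<And>x t. (x, t) \<in> S \<Longrightarrow> parabolic_interior S x t \<Longrightarrow> u x t = U x t \<Longrightarrow>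
      \<exists>Ut L. (U x has_real_derivative Ut) (at t) \<and> has_laplacian (\<lambda>z. U z t) L x \<and> L + f x t < Ut"
    and xt: "(x, t) \<in> S"
  shows "u x t < U x t"
proof -
  have "u x t - U x t < 0"
  proof (rule no_touching_imp_negative[OF S _ _ _ xt])
    show "continuous_on S (\<lambda>(x, t). u x t - U x t)"
      using continuous_on_diff[OF _ U, of "\<lambda>(x, t). u x t"] u
      unfolding solves_heat_def by (simp add: case_prod_unfold)
    show "parabolic_interior S x t" if "(x, t) \<in> S" "0 \<le> u x t - U x t" for x t
      using boundary that by force
    fix x t assume xt: "(x, t) \<in> S" "u x t - U x t = 0"
    then have int: "parabolic_interior S x t"
      using boundary by force
    obtain M where M: "(u x has_real_derivative (M + f x t)) (at t)" "has_laplacian (\<lambda>z. u z t) M x"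
      using u xt unfolding solves_heat_def by blast
    obtain Ut L where L: "(U x has_real_derivative Ut) (at t)" "has_laplacian (\<lambda>z. U z t) L x"
        "L + f x t < Ut"
      using strict[OF xt(1) int] xt(2) by auto
    show "\<exists>wt L. ((\<lambda>t. u x t - U x t) has_real_derivative wt) (at t) \<and>
        has_laplacian (\<lambda>z. u z t - U z t) L x \<and> wt < L"
      using DERIV_diff[OF M(1) L(1)] has_laplacian_diff[OF M(2) L(2)] L(3)
      by (intro exI[of _ "M + f x t - Ut"] exI[of _ "M - L"]) auto
  qed
  then show ?thesis by simp
qed

lemma parabolic_interior_cylinder:
  assumes "dist p x < \<rho>" "t1 < t" "t \<le> t2"
  shows "parabolic_interior (cball p \<rho> \<times> {t1..t2}) x t"
  unfolding parabolic_interior_def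
proof (intro exI conjI allI impI)
  show "0 < min (\<rho> - dist p x) (t - t1)" using assms by simp
  show "(z, t) \<in> cball p \<rho> \<times> {t1..t2}" if "dist z x < min (\<rho> - dist p x) (t - t1)" for z
    using assms that dist_triangle[of p z x] by (simp add: dist_commute)
  show "(x, s) \<in> cball p \<rho> \<times> {t1..t2}"
    if "t - min (\<rho> - dist p x) (t - t1) < s \<and> s \<le> t" for s
    using assms that by auto
qed

section \<open>Local bounds up to the blow-up time\<close>

lemma inverse_sqrt_remaining_time_deriv:
  assumes "t < T"
  shows "((\<lambda>t. 1 / sqrt (T - t)) has_real_derivative 1 / sqrt (T - t) / (2 * (T - t))) (at t)"
  using assms
  by (auto intro!: derivative_eq_intros simp: field_simps power2_eq_square)

text \<open>With \<open>\<tau> = T - t\<close>, the barrier is a power \<open>k = 4 M\<close> of \<open>g = 1 + \<bar>x - p\<bar>\<^sup>2 / (l \<surd>\<tau>)\<close>, on a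
  logarithmic scale. Where \<open>g \<ge> 2\<close>, the term \<open>k ln g\<close> grows at least at the rate
  \<open>k / (4 \<tau>) = M / \<tau>\<close>, which by the type I rate pays for the source. Where \<open>g < 2\<close>, the barrier is
  so low that the source is at most \<open>E / l\<^sup>2\<close>. The factor \<open>1 / \<surd>\<tau>\<close> in \<open>g\<close>, instead of the
  self-similar \<open>1 / \<tau>\<close>, makes the loss \<open>2 N k / (l \<surd>\<tau>)\<close> due to diffusion integrable in time. The
  function \<open>B\<close> integrates both losses, and \<open>\<theta>\<close> is so small that \<open>B \<le> 1\<close>. On the lateral boundary
  \<open>k \<ge> 4\<close> makes the barrier exceed the type I bound.\<close>
lemma type_I_local_upper_bound:
  fixes u :: "'a::euclidean_space \<Rightarrow> real \<Rightarrow> real"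
  assumes l: "0 < l" and M: "1 \<le> M"
    and heat: "solves_heat (cball p (l / 2) \<times> {T - \<theta> * l\<^sup>2..<T}) u (\<lambda>x t. exp (u x t))"
    and type_I: "\<And>x t. x \<in> cball p (l / 2) \<Longrightarrow> t \<in> {T - \<theta> * l\<^sup>2..<T} \<Longrightarrow>
      u x t \<le> ln M - ln (T - t)"
    and start: "\<And>x. x \<in> cball p (l / 2) \<Longrightarrow> u x (T - \<theta> * l\<^sup>2) \<le> c - 2 * ln l"
    and \<theta>: "0 < \<theta>" "\<theta> \<le> 1 / 16"
      "16 * real DIM('a) * M * sqrt \<theta> + exp (c + 3 + 4 * M * ln 2) * \<theta> \<le> 1"
      "ln \<theta> < c + 1 - 4 * ln 4 - ln M"
    and t: "t \<in> {T - \<theta> * l\<^sup>2..<T}"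
  shows "u p t \<le> c + 2 - 2 * ln l"
proof -
  define N k E where "N = real DIM('a)" and "k = 4 * M" and "E = exp (c + 3 + 4 * M * ln 2)"
  define a where "a = (\<lambda>t. 1 / sqrt (T - t) / l)"
  define B where "B = (\<lambda>t. 4 * N * k * (sqrt \<theta> - sqrt (T - t) / l) + E * (\<theta> - (T - t) / l\<^sup>2))"
  define U where "U = (\<lambda>x t. c + 1 - 2 * ln l + B t + k * ln (1 + a t * (norm (x - p))\<^sup>2))"
  have pos: "0 < N" "4 \<le> k" "0 < E"
    using M unfolding N_def k_def E_def by auto
  have a_pos: "0 < a s" if "s < T" for s
    using that l unfolding a_def by simp
  have B_le: "B s \<le> 1" if "s < T" for s
  proof -
    have "4 * N * k * (sqrt \<theta> - sqrt (T - s) / l) \<le> 4 * N * k * sqrt \<theta>"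
      using pos that l by (intro mult_left_mono) auto
    moreover have "E * (\<theta> - (T - s) / l\<^sup>2) \<le> E * \<theta>"
      using pos that l by (intro mult_left_mono) auto
    ultimately show ?thesis
      using \<theta>(3) unfolding B_def N_def[symmetric] E_def[symmetric] by (simp add: k_def)
  qed
  have B_nonneg: "0 \<le> B s" if "s \<in> {T - \<theta> * l\<^sup>2..<T}" for s
  proof -
    have le: "T - s \<le> \<theta> * l\<^sup>2" using that by auto
    then have "sqrt (T - s) \<le> sqrt \<theta> * l"
      using l by (metis real_sqrt_le_mono real_sqrt_mult real_sqrt_abs abs_of_pos)
    then have "0 \<le> sqrt \<theta> - sqrt (T - s) / l" "0 \<le> \<theta> - (T - s) / l\<^sup>2"
      using l le by (simp_all add: field_simps)
    then show ?thesis using pos unfolding B_def by simp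
  qed
  have "u p t < U p t"
  proof (rule heat_comparison[where S = "cball p (l / 2) \<times> {T - \<theta> * l\<^sup>2..t}"
        and u = u and U = U and f = "\<lambda>x t. exp (u x t)"])
    let ?S = "cball p (l / 2) \<times> {T - \<theta> * l\<^sup>2..t}"
    show "compact ?S" by (intro compact_Times) auto
    show "solves_heat ?S u (\<lambda>x t. exp (u x t))"
      using t by (intro solves_heat_subset[OF heat]) auto
    show "(p, t) \<in> ?S" using l t by auto
    have "1 + a s * (norm (x - p))\<^sup>2 \<noteq> 0" if "s < T" for x s
      using a_pos[OF that] by (simp add: add_pos_nonneg less_imp_neq[symmetric])
    then show "continuous_on ?S (\<lambda>(x, t). U x t)"
      using t l unfolding U_def B_def a_def case_prod_unfold
      by (intro continuous_intros) auto
    fix x s assume xs: "(x, s) \<in> ?S"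
    then have s: "s \<in> {T - \<theta> * l\<^sup>2..<T}" "s \<le> t" and x: "x \<in> cball p (l / 2)"
      using t by auto
    define \<rho> where "\<rho> = (norm (x - p))\<^sup>2"
    have \<rho>: "0 \<le> \<rho>" unfolding \<rho>_def by simp
    have \<tau>: "0 < T - s" "T - s \<le> \<theta> * l\<^sup>2" using s by auto
    have g: "1 \<le> 1 + a s * \<rho>"
      using a_pos[of s] s \<rho> by simp
    show "u x s < U x s" if not_int: "\<not> parabolic_interior ?S x s"
    proof (cases "s = T - \<theta> * l\<^sup>2")
      case True
      have "0 \<le> k * ln (1 + a s * \<rho>)"
        using g pos by simp
      then show ?thesis
        using start[OF x] B_nonneg[OF s(1)] True unfolding U_def \<rho>_def[symmetric] by simp
    next
      case False
      then have "dist p x = l / 2"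
        using parabolic_interior_cylinder[of p x "l / 2" "T - \<theta> * l\<^sup>2" s t] not_int x s by force
      then have \<rho>_eq: "\<rho> = (l / 2)\<^sup>2"
        unfolding \<rho>_def by (simp only: dist_norm norm_minus_commute)
      define r where "r = l / (4 * sqrt (T - s))"
      have "a s * \<rho> = r"
        unfolding a_def \<rho>_eq r_def using l by (simp add: power2_eq_square field_simps)
      have "16 * (T - s) \<le> l\<^sup>2"
        using \<tau>(2) \<theta>(2) mult_right_mono[OF \<theta>(2), of "l\<^sup>2"] by simp
      then have "sqrt (16 * (T - s)) \<le> l"
        using l real_le_lsqrt by auto
      then have "4 * sqrt (T - s) \<le> l"
        by (simp only: real_sqrt_mult) simp
      then have r: "1 \<le> r"
        unfolding r_def using \<tau> by simp
      have "ln (T - s) \<le> ln (\<theta> * l\<^sup>2)"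
        using \<tau> by (subst ln_le_cancel_iff) auto
      also have "\<dots> = ln \<theta> + 2 * ln l"
        using \<theta> l by (simp add: ln_mult ln_realpow)
      finally have ln_\<tau>: "ln (T - s) \<le> ln \<theta> + 2 * ln l" .
      have "4 * ln r \<le> k * ln (1 + r)"
        using r pos by (intro mult_mono) auto
      moreover have "ln r = ln l - ln 4 - ln (T - s) / 2"
        unfolding r_def using l \<tau> by (simp add: ln_div ln_mult ln_sqrt)
      ultimately show ?thesis
        using type_I[OF x s(1)] B_nonneg[OF s(1)] ln_\<tau> \<theta>(4)
        unfolding U_def \<rho>_def[symmetric] \<open>a s * \<rho> = r\<close> by (simp add: algebra_simps)
    qed
    assume "u x s = U x s"
    let ?L = "k * (2 * N * (a s / (1 + a s * \<rho>)) + 4 * \<rho> * (- (a s)\<^sup>2 / (1 + a s * \<rho>)\<^sup>2))"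
    let ?Ut = "2 * N * k * a s + E / l\<^sup>2 + k * (a s / (2 * (T - s)) * \<rho> / (1 + a s * \<rho>))"
    have a_deriv: "(a has_real_derivative a s / (2 * (T - s))) (at s)"
      using DERIV_cdivide[OF inverse_sqrt_remaining_time_deriv, of s T l] \<tau>
      unfolding a_def by (simp add: field_simps)
    have "(B has_real_derivative 4 * N * k * (0 - - (1 / sqrt (T - s)) / 2 / l) + E * (1 / l\<^sup>2)) (at s)"
      unfolding B_def using \<tau> l
      by (auto intro!: derivative_eq_intros simp: field_simps)
    then have B_deriv: "(B has_real_derivative 2 * N * k * a s + E / l\<^sup>2) (at s)"
      unfolding a_def by (simp add: mult_ac)
    have "(U x has_real_derivative ?Ut) (at s)"
      unfolding U_def \<rho>_def[symmetric] using g
      by (auto intro!: derivative_eq_intros B_deriv a_deriv simp: field_simps)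
    moreover have "has_laplacian (\<lambda>z. U z s) ?L x"
    proof -
      have "has_laplacian (\<lambda>z. ln (1 + a s * (norm (z - p))\<^sup>2))
         (2 * real DIM('a) * (a s / (1 + a s * (norm (x - p))\<^sup>2)) +
          4 * (norm (x - p))\<^sup>2 * (- (a s)\<^sup>2 / (1 + a s * (norm (x - p))\<^sup>2)\<^sup>2)) x"
      proof (rule has_laplacian_radial)
        have "\<forall>\<^sub>F r in nhds \<rho>. r > - 1 / a s"
          using eventually_nhds_in_open[of "{- 1 / a s<..}" \<rho>] a_pos[of s] \<tau> \<rho>
          by (simp add: less_le_trans[of _ 0])
        then show "\<forall>\<^sub>F r in nhds ((norm (x - p))\<^sup>2).
            ((\<lambda>r. ln (1 + a s * r)) has_real_derivative a s / (1 + a s * r)) (at r)"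
          unfolding \<rho>_def[symmetric]
          by eventually_elim
            (use a_pos[of s] \<tau> in \<open>auto intro!: derivative_eq_intros simp: field_simps\<close>)
        show "((\<lambda>r. a s / (1 + a s * r)) has_real_derivative
            - (a s)\<^sup>2 / (1 + a s * (norm (x - p))\<^sup>2)\<^sup>2) (at ((norm (x - p))\<^sup>2))"
          using g unfolding \<rho>_def[symmetric]
          by (auto intro!: derivative_eq_intros simp: power2_eq_square)
      qed
      then have "has_laplacian (\<lambda>z. (c + 1 - 2 * ln l + B s) + k * ln (1 + a s * (norm (z - p))\<^sup>2))
          (0 + ?L) x"
        unfolding N_def \<rho>_def by (intro has_laplacian_add has_laplacian_cmult has_laplacian_const)
      then show ?thesis unfolding U_def by simp
    qed
    moreover have "?L + exp (u x s) < ?Ut"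
    proof -
      have as: "0 < a s" using a_pos \<tau> by simp
      have "a s / (1 + a s * \<rho>) \<le> a s"
        using divide_left_mono[OF g, of "a s"] as g by simp
      then have "2 * N * (a s / (1 + a s * \<rho>)) \<le> 2 * N * a s"
        using pos by (intro mult_left_mono) auto
      moreover have "4 * \<rho> * (- (a s)\<^sup>2 / (1 + a s * \<rho>)\<^sup>2) \<le> 0"
        using \<rho> by (simp add: divide_nonpos_nonneg mult_nonneg_nonpos)
      ultimately have "k * (2 * N * (a s / (1 + a s * \<rho>)) + 4 * \<rho> * (- (a s)\<^sup>2 / (1 + a s * \<rho>)\<^sup>2))
          \<le> k * (2 * N * a s)"
        using pos by (intro mult_left_mono) linarith+
      then have L_le: "?L \<le> 2 * N * k * a s" by (simp add: mult_ac)
      have "exp (u x s) < E / l\<^sup>2 + k * (a s / (2 * (T - s)) * \<rho> / (1 + a s * \<rho>))"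
      proof (cases "2 \<le> 1 + a s * \<rho>")
        case True
        have "exp (u x s) \<le> exp (ln M - ln (T - s))"
          using type_I[OF x s(1)] by simp
        also have "\<dots> = M / (T - s)"
          using M \<tau> by (simp add: exp_diff)
        also have "\<dots> = k / (2 * (T - s)) * (1 / 2)"
          using \<tau> by (simp add: k_def field_simps)
        also have "\<dots> \<le> k / (2 * (T - s)) * (a s * \<rho> / (1 + a s * \<rho>))"
          using True pos \<tau> by (intro mult_left_mono) (auto simp: field_simps)
        also have "\<dots> = k * (a s / (2 * (T - s)) * \<rho> / (1 + a s * \<rho>))"
          by simp
        finally show ?thesis using pos l by (simp add: add_strict_increasing)
      next
        case False
        have "k * ln (1 + a s * \<rho>) \<le> k * ln 2"
          using False g pos by (intro mult_left_mono) auto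
        then have "u x s < c + 3 + 4 * M * ln 2 - 2 * ln l"
          using B_le[of s] \<tau> \<open>u x s = U x s\<close> unfolding U_def \<rho>_def[symmetric]
          by (simp add: k_def)
        then have "exp (u x s) < exp (c + 3 + 4 * M * ln 2 - 2 * ln l)" by simp
        also have "\<dots> = E / l\<^sup>2"
          using l by (simp add: E_def exp_diff exp_double[of "ln l"])
        finally have "exp (u x s) < E / l\<^sup>2" .
        moreover have "0 \<le> k * (a s / (2 * (T - s)) * \<rho> / (1 + a s * \<rho>))"
          using pos as \<rho> \<tau> g by (intro mult_nonneg_nonneg divide_nonneg_nonneg) auto
        ultimately show ?thesis by linarith
      qed
      with L_le show ?thesis by linarith
    qed
    ultimately show "\<exists>Ut L. (U x has_real_derivative Ut) (at s) \<and>
        has_laplacian (\<lambda>z. U z s) L x \<and> L + exp (u x s) < Ut"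
      by blast
  qed
  then show ?thesis
    using B_le[of t] t unfolding U_def by simp
qed

lemma parabolic_interior_open:
  fixes x :: "'a::metric_space"
  assumes "open W" "(x, t) \<in> W" and sub: "\<And>z s. (z, s) \<in> W \<Longrightarrow> s \<le> t \<Longrightarrow> (z, s) \<in> S"
  shows "parabolic_interior S x t"
proof -
  obtain d where d: "d > 0" "ball (x, t) d \<subseteq> W"
    using assms(1,2) open_contains_ball by blast
  have "(z, t) \<in> S" if "dist z x < d" for z
    using that d(2) sub[of z t] by (simp add: subset_eq dist_Pair_Pair dist_commute)
  moreover have "(x, s) \<in> S" if "t - d < s" "s \<le> t" for s
    using that d(2) sub[of x s] by (simp add: subset_eq dist_Pair_Pair dist_real_def)
  ultimately show ?thesis
    unfolding parabolic_interior_def using d(1) by blast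
qed

text \<open>A logarithmic singularity on the lateral boundary cannot reach the centre of the ball. The
  barrier \<open>k \<bar>x - p\<bar>\<^sup>2 / \<surd>\<tau>\<close> dominates \<open>- ln \<tau>\<close> on the boundary, while diffusion costs it only
  \<open>2 N k / \<surd>\<tau>\<close>, which is integrable up to \<open>\<tau> = 0\<close>. For \<open>v = - u\<close> this yields the lower bounds on \<open>u\<close>.\<close>
lemma log_bounded_subsolution_bounded:
  fixes v :: "'a::euclidean_space \<Rightarrow> real \<Rightarrow> real"
  assumes r: "0 < r" and t0: "t0 < T"
    and heat: "solves_heat (cball p r \<times> {t0..<T}) v f"
    and f: "\<And>x t. x \<in> cball p r \<Longrightarrow> t \<in> {t0..<T} \<Longrightarrow> f x t \<le> 0"
    and log: "\<And>x t. x \<in> cball p r \<Longrightarrow> t \<in> {t0..<T} \<Longrightarrow> v x t \<le> c - ln (T - t)"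
    and start: "\<And>x. x \<in> cball p r \<Longrightarrow> v x t0 \<le> m"
    and k: "2 + (\<bar>c\<bar> + \<bar>m\<bar>) * sqrt (T - t0) \<le> k * r\<^sup>2"
    and t: "t \<in> {t0..<T}"
  shows "v p t \<le> m + 1 + 4 * real DIM('a) * k * sqrt (T - t0) + (T - t0)"
proof -
  define N where "N = real DIM('a)"
  define a where "a = (\<lambda>t. 1 / sqrt (T - t))"
  define B where "B = (\<lambda>t. 4 * N * k * (sqrt (T - t0) - sqrt (T - t)) + (t - t0))"
  define U where "U = (\<lambda>x t. m + 1 + B t + k * (a t * (norm (x - p))\<^sup>2))"
  have "0 < 2 + (\<bar>c\<bar> + \<bar>m\<bar>) * sqrt (T - t0)"
    using t0 by (intro add_pos_nonneg) auto
  then have "0 < k * r\<^sup>2" using k by simp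
  then have pos: "0 < N" "0 < k"
    using r unfolding N_def by (auto simp: zero_less_mult_iff)
  have B_nonneg: "0 \<le> B s" if "s \<in> {t0..<T}" for s
    using that pos unfolding B_def by simp
  have "v p t < U p t"
  proof (rule heat_comparison[where S = "cball p r \<times> {t0..t}" and u = v and U = U and f = f])
    let ?S = "cball p r \<times> {t0..t}"
    show "compact ?S" by (intro compact_Times) auto
    show "solves_heat ?S v f"
      using t by (intro solves_heat_subset[OF heat]) auto
    show "(p, t) \<in> ?S" using r t by auto
    show "continuous_on ?S (\<lambda>(x, t). U x t)"
      using t unfolding U_def B_def a_def case_prod_unfold
      by (intro continuous_intros) auto
    fix x s assume xs: "(x, s) \<in> ?S"
    then have s: "s \<in> {t0..<T}" "s \<le> t" and x: "x \<in> cball p r"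
      using t by auto
    define \<rho> where "\<rho> = (norm (x - p))\<^sup>2"
    have \<rho>: "0 \<le> \<rho>" unfolding \<rho>_def by simp
    have \<tau>: "0 < T - s" "T - s \<le> T - t0" using s by auto
    then have a_pos: "0 < a s" unfolding a_def by simp
    show "v x s < U x s" if not_int: "\<not> parabolic_interior ?S x s"
    proof (cases "s = t0")
      case True
      have "0 \<le> k * (a s * \<rho>)"
        using a_pos pos \<rho> by simp
      then show ?thesis
        using start[OF x] B_nonneg[OF s(1)] True unfolding U_def \<rho>_def[symmetric] by simp
    next
      case False
      then have "dist p x = r"
        using parabolic_interior_cylinder[of p x r t0 s t] not_int x s by force
      then have \<rho>_eq: "\<rho> = r\<^sup>2"
        unfolding \<rho>_def by (simp only: dist_norm norm_minus_commute)
      have "ln (a s) \<le> a s"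
        using ln_le_minus_one[OF a_pos] by simp
      moreover have "ln (a s) = - ln (T - s) / 2"
        unfolding a_def using \<tau> by (simp add: ln_div ln_sqrt)
      ultimately have "- ln (T - s) \<le> 2 * a s" by simp
      moreover have "(2 + (\<bar>c\<bar> + \<bar>m\<bar>) * sqrt (T - s)) * a s \<le> (k * r\<^sup>2) * a s"
      proof (rule mult_right_mono)
        have "(\<bar>c\<bar> + \<bar>m\<bar>) * sqrt (T - s) \<le> (\<bar>c\<bar> + \<bar>m\<bar>) * sqrt (T - t0)"
          using \<tau> by (intro mult_left_mono) auto
        then show "2 + (\<bar>c\<bar> + \<bar>m\<bar>) * sqrt (T - s) \<le> k * r\<^sup>2" using k by simp
      qed (use a_pos in simp)
      moreover have "(2 + (\<bar>c\<bar> + \<bar>m\<bar>) * sqrt (T - s)) * a s = 2 * a s + \<bar>c\<bar> + \<bar>m\<bar>"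
        unfolding a_def using \<tau> by (simp add: field_simps)
      ultimately have "c - ln (T - s) \<le> k * (a s * \<rho>) + m"
        unfolding \<rho>_eq by (simp add: mult_ac)
      then show ?thesis
        using log[OF x s(1)] B_nonneg[OF s(1)]
        unfolding U_def \<rho>_def[symmetric] by simp
    qed
    let ?L = "k * (2 * N * a s)"
    let ?Ut = "2 * N * k * a s + 1 + k * (a s / (2 * (T - s)) * \<rho>)"
    have a_deriv: "(a has_real_derivative a s / (2 * (T - s))) (at s)"
      using inverse_sqrt_remaining_time_deriv[of s T] \<tau> unfolding a_def by simp
    have "(B has_real_derivative 4 * N * k * (0 - - (1 / sqrt (T - s)) / 2) + 1) (at s)"
      unfolding B_def using \<tau>
      by (auto intro!: derivative_eq_intros simp: field_simps)
    then have B_deriv: "(B has_real_derivative 2 * N * k * a s + 1) (at s)"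
      unfolding a_def by (simp add: mult_ac)
    have "(U x has_real_derivative ?Ut) (at s)"
      unfolding U_def \<rho>_def[symmetric]
      by (auto intro!: derivative_eq_intros B_deriv a_deriv simp: field_simps)
    moreover have "has_laplacian (\<lambda>z. U z s) ?L x"
    proof -
      have "has_laplacian (\<lambda>z. a s * (norm (z - p))\<^sup>2)
         (2 * real DIM('a) * a s + 4 * (norm (x - p))\<^sup>2 * 0) x"
        by (rule has_laplacian_radial) (auto intro!: derivative_eq_intros always_eventually)
      then have "has_laplacian (\<lambda>z. (m + 1 + B s) + k * (a s * (norm (z - p))\<^sup>2)) 
          (0 + k * (2 * real DIM('a) * a s + 4 * (norm (x - p))\<^sup>2 * 0)) x"
        by (intro has_laplacian_add has_laplacian_cmult has_laplacian_const)
      then show ?thesis unfolding U_def N_def by simp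
    qed
    moreover have "?L + f x s < ?Ut"
    proof -
      have "0 \<le> k * (a s / (2 * (T - s)) * \<rho>)"
        using pos a_pos \<tau> \<rho> by simp
      then show ?thesis using f[OF x s(1)] by (simp add: mult_ac)
    qed
    ultimately show "\<exists>Ut L. (U x has_real_derivative Ut) (at s) \<and>
        has_laplacian (\<lambda>z. U z s) L x \<and> L + f x s < Ut"
      by blast
  qed
  moreover have "4 * N * k * (sqrt (T - t0) - sqrt (T - t)) \<le> 4 * N * k * sqrt (T - t0)"
    using pos t by (intro mult_left_mono) auto
  ultimately show ?thesis
    using t unfolding U_def B_def N_def[symmetric] by simp
qed

section \<open>Comparison outside a paraboloid\<close>

definition paraboloid_exterior :: "real \<Rightarrow> real \<Rightarrow> real \<Rightarrow> ('a::real_normed_vector \<times> real) set" where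
  "paraboloid_exterior T K r = {(x, t). t < T \<and> K\<^sup>2 * (T - t) \<le> (norm x)\<^sup>2 \<and> norm x \<le> r}"

text \<open>The barrier has three parts. The profile \<open>c - 2 q ln \<bar>x\<bar>\<close> has a Laplacian of order
  \<open>1 / \<bar>x\<bar>\<^sup>2\<close>, like the source. The term \<open>A (1 / K\<^sup>2 - \<tau> / \<bar>x\<bar>\<^sup>2)\<close> increases in time at the rate
  \<open>A / \<bar>x\<bar>\<^sup>2\<close> and so pays for both if \<open>A\<close> is large; it vanishes on the inner boundary
  \<open>\<bar>x\<bar>\<^sup>2 = K\<^sup>2 \<tau>\<close> and never exceeds \<open>A / K\<^sup>2\<close>. The caloric polynomial \<open>\<Lambda> (\<bar>x\<bar>\<^sup>2 - 2 N \<tau>)\<close> is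
  nonnegative in the region, can be made to dominate any bound on the outer boundary, and still
  vanishes at \<open>(0, T)\<close>. The constant \<open>A\<close> depends neither on \<open>m\<close> nor on \<open>r\<close>. The cases \<open>q = 1\<close>
  and \<open>q = - 1\<close> give the upper and the lower bound for the profile.\<close>
lemma paraboloid_exterior_upper_bound:
  fixes v :: "'a::euclidean_space \<Rightarrow> real \<Rightarrow> real"
  assumes r: "0 < r" and K: "0 < K" "4 * real DIM('a) \<le> K\<^sup>2" and q: "\<bar>q\<bar> \<le> 1" and \<epsilon>: "0 < \<epsilon>"
    and heat: "solves_heat (paraboloid_exterior T K r) v f"
    and f: "\<And>x t. (x, t) \<in> paraboloid_exterior T K r \<Longrightarrow> f x t \<le> A0 / (norm x)\<^sup>2" "0 \<le> A0"
    and inner: "\<And>x t. (x, t) \<in> paraboloid_exterior T K r \<Longrightarrow> (norm x)\<^sup>2 = K\<^sup>2 * (T - t) \<Longrightarrow>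
      v x t \<le> c + \<epsilon> - 2 * q * ln (norm x)"
    and outer: "\<And>x t. (x, t) \<in> paraboloid_exterior T K r \<Longrightarrow> norm x = r \<Longrightarrow> v x t \<le> m"
  shows "\<exists>\<Lambda>. \<forall>(x, t)\<in>paraboloid_exterior T K r. v x t \<le>
    c + 2 * \<epsilon> - 2 * q * ln (norm x) + 2 * (A0 + 2 * real DIM('a) + 5) / K\<^sup>2 + \<Lambda> * (norm x)\<^sup>2"
proof -
  let ?D = "paraboloid_exterior T K r :: ('a \<times> real) set"
  define N A where "N = real DIM('a)" and "A = 2 * (A0 + 2 * N + 5)"
  define \<Lambda> where "\<Lambda> = 2 * (\<bar>m\<bar> + \<bar>c\<bar> + \<bar>ln (r\<^sup>2)\<bar>) / r\<^sup>2"
  define U where "U = (\<lambda>(x::'a) t. c + 2 * \<epsilon> - q * ln ((norm x)\<^sup>2) +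
    A * (1 / K\<^sup>2 - (T - t) / (norm x)\<^sup>2) + \<Lambda> * ((norm x)\<^sup>2 - 2 * N * (T - t)))"
  have N: "1 \<le> N" unfolding N_def using DIM_positive[where 'a = 'a] by simp
  have A: "0 < A" unfolding A_def using N f(2) by simp
  have \<Lambda>: "0 \<le> \<Lambda>" unfolding \<Lambda>_def using r by simp
  have D: "0 < T - t" "0 < (norm x)\<^sup>2" "K\<^sup>2 * (T - t) \<le> (norm x)\<^sup>2" "norm x \<le> r"
      "(T - t) / (norm x)\<^sup>2 \<le> 1 / K\<^sup>2" "4 * N * (T - t) \<le> (norm x)\<^sup>2"
    if "(x, t) \<in> ?D" for x t
  proof -
    show 1: "0 < T - t" and 2: "K\<^sup>2 * (T - t) \<le> (norm x)\<^sup>2" and "norm x \<le> r"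
      using that unfolding paraboloid_exterior_def by auto
    have "0 < K\<^sup>2 * (T - t)" using 1 K(1) by simp
    with 2 show 3: "0 < (norm x)\<^sup>2" by linarith
    show "(T - t) / (norm x)\<^sup>2 \<le> 1 / K\<^sup>2"
      using 2 3 K(1) by (simp add: field_simps)
    show "4 * N * (T - t) \<le> (norm x)\<^sup>2"
      using 2 mult_right_mono[OF K(2), of "T - t"] 1 unfolding N_def by linarith
  qed
  have "v x t < U x t" if xt: "(x, t) \<in> ?D" for x t
  proof -
    define S where "S = ?D \<inter> {(z, s). s \<le> t}"
    have S_D: "(z, s) \<in> ?D" if "(z, s) \<in> S" for z s
      using that unfolding S_def by auto
    have tT: "t < T" using D[OF xt] by simp
    show ?thesis
    proof (rule heat_comparison[where S = S and u = v and U = U and f = f])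
      show "(x, t) \<in> S" using xt unfolding S_def by simp
      show "compact S"
      proof -
        have S_eq: "S = {P. K\<^sup>2 * (T - snd P) \<le> (norm (fst P))\<^sup>2} \<inter> {P. norm (fst P) \<le> r} \<inter>
            {P. snd P \<le> t}"
          using tT unfolding S_def paraboloid_exterior_def by auto
        have "closed S"
          unfolding S_eq by (intro closed_Int closed_Collect_le continuous_intros)
        moreover have "S \<subseteq> cball 0 r \<times> {T - r\<^sup>2 / K\<^sup>2..t}"
        proof clarify
          fix z s assume zs: "(z, s) \<in> S"
          then have "(norm z)\<^sup>2 \<le> r\<^sup>2" "K\<^sup>2 * (T - s) \<le> (norm z)\<^sup>2"
            using D[OF S_D[OF zs]] by (auto intro: power_mono)
          then have "K\<^sup>2 * (T - s) \<le> r\<^sup>2" by linarith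
          then have "T - s \<le> r\<^sup>2 / K\<^sup>2"
            using K(1) by (simp add: field_simps)
          then show "z \<in> cball 0 r \<and> s \<in> {T - r\<^sup>2 / K\<^sup>2..t}"
            using zs D[OF S_D[OF zs]] unfolding S_def by auto
        qed
        ultimately show ?thesis
          using closed_Int_compact[OF _ compact_Times[OF compact_cball compact_Icc]]
          by (metis Int_absorb2)
      qed
      show "solves_heat S v f"
        by (rule solves_heat_subset[OF heat]) (auto simp: S_def)
      have "norm z \<noteq> 0" if "(z, s) \<in> S" for z s
        using D(2)[OF S_D[OF that]] by auto
      then show "continuous_on S (\<lambda>(x, t). U x t)"
        unfolding U_def case_prod_unfold by (intro continuous_intros) auto
      fix z s assume zs: "(z, s) \<in> S"
      note zD = S_D[OF zs]
      define \<rho> \<tau> where "\<rho> = (norm z)\<^sup>2" and "\<tau> = T - s"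
      note D' = D[OF zD, folded \<rho>_def \<tau>_def]
      have ln\<rho>: "ln \<rho> = 2 * ln (norm z)"
        unfolding \<rho>_def using D'(2) by (subst ln_realpow) auto
      have Ui: "U z s = c + 2 * \<epsilon> - q * ln \<rho> + A * (1 / K\<^sup>2 - \<tau> / \<rho>) + \<Lambda> * (\<rho> - 2 * N * \<tau>)"
        unfolding U_def \<rho>_def \<tau>_def ..
      have A_term: "0 \<le> A * (1 / K\<^sup>2 - \<tau> / \<rho>)"
        using A D'(5) by simp
      have \<Lambda>_term: "\<Lambda> * (\<rho> / 2) \<le> \<Lambda> * (\<rho> - 2 * N * \<tau>)"
        using \<Lambda> D'(6) by (intro mult_left_mono) auto
      show "v z s < U z s" if not_int: "\<not> parabolic_interior S z s"
      proof -
        have "\<not> (K\<^sup>2 * \<tau> < \<rho> \<and> norm z < r)"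
        proof
          assume strict: "K\<^sup>2 * \<tau> < \<rho> \<and> norm z < r"
          have "parabolic_interior S z s"
          proof (rule parabolic_interior_open)
            let ?W = "{P :: 'a \<times> real. K\<^sup>2 * (T - snd P) < (norm (fst P))\<^sup>2} \<inter> {P. norm (fst P) < r}"
            show "open ?W" by (intro open_Int open_Collect_less continuous_intros)
            show "(z, s) \<in> ?W" using strict unfolding \<rho>_def \<tau>_def by simp
            show "(y, s') \<in> S" if "(y, s') \<in> ?W" "s' \<le> s" for y s'
              using that zs tT unfolding S_def paraboloid_exterior_def by auto
          qed
          with not_int show False ..
        qed
        then consider "\<rho> = K\<^sup>2 * \<tau>" | "norm z = r"
          using D'(3,4) by linarith
        then show ?thesis
        proof cases
          case 1
          have "v z s \<le> c + \<epsilon> - q * ln \<rho>"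
            using inner[OF zD] 1 unfolding ln\<rho> \<rho>_def[symmetric] \<tau>_def[symmetric] by simp
          moreover have "0 \<le> \<Lambda> * (\<rho> / 2)" using \<Lambda> D'(2) by simp
          ultimately show ?thesis
            using A_term \<Lambda>_term \<epsilon> unfolding Ui by linarith
        next
          case 2
          then have \<rho>_eq: "\<rho> = r\<^sup>2" unfolding \<rho>_def by simp
          have "\<Lambda> * (\<rho> / 2) = \<bar>m\<bar> + \<bar>c\<bar> + \<bar>ln \<rho>\<bar>"
            unfolding \<Lambda>_def \<rho>_eq using r by simp
          moreover have "q * ln \<rho> \<le> \<bar>ln \<rho>\<bar>"
            using mult_right_mono[OF q, of "\<bar>ln \<rho>\<bar>"] abs_ge_self[of "q * ln \<rho>"]
            by (simp add: abs_mult)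
          ultimately show ?thesis
            using A_term \<Lambda>_term \<epsilon> outer[OF zD 2] unfolding Ui by linarith
        qed
      qed
      let ?L = "2 * N * (- q / \<rho> + A * \<tau> / \<rho>\<^sup>2 + \<Lambda>) + 4 * \<rho> * (q / \<rho>\<^sup>2 - 2 * A * \<tau> / \<rho> ^ 3)"
      let ?Ut = "A / \<rho> + 2 * N * \<Lambda>"
      have "(U z has_real_derivative ?Ut) (at s)"
        unfolding U_def \<rho>_def[symmetric] using D'(2)
        by (auto intro!: derivative_eq_intros simp: field_simps)
      moreover have "has_laplacian (\<lambda>y. U y s) ?L z"
      proof -
        let ?G = "\<lambda>\<rho>. c + 2 * \<epsilon> - q * ln \<rho> + A * (1 / K\<^sup>2 - \<tau> / \<rho>) + \<Lambda> * (\<rho> - 2 * N * \<tau>)"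
        let ?G1 = "\<lambda>\<rho>. - q / \<rho> + A * \<tau> / \<rho>\<^sup>2 + \<Lambda>"
        have "has_laplacian (\<lambda>y. ?G ((norm (y - 0))\<^sup>2))
            (2 * real DIM('a) * ?G1 ((norm (z - 0))\<^sup>2) +
             4 * (norm (z - 0))\<^sup>2 * (q / \<rho>\<^sup>2 - 2 * A * \<tau> / \<rho> ^ 3)) z"
        proof (rule has_laplacian_radial)
          have "\<forall>\<^sub>F r in nhds \<rho>. 0 < r"
            using eventually_nhds_in_open[of "{0<..}" \<rho>] D'(2) by simp
          then show "\<forall>\<^sub>F r in nhds ((norm (z - 0))\<^sup>2). (?G has_real_derivative ?G1 r) (at r)"
            unfolding diff_zero \<rho>_def[symmetric]
            by eventually_elim
              (auto intro!: derivative_eq_intros simp: field_simps power2_eq_square)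
          show "(?G1 has_real_derivative q / \<rho>\<^sup>2 - 2 * A * \<tau> / \<rho> ^ 3) (at ((norm (z - 0))\<^sup>2))"
            unfolding diff_zero \<rho>_def[symmetric] using D'(2)
            by (auto intro!: derivative_eq_intros
                simp: field_simps power2_eq_square power3_eq_cube)
        qed
        then show ?thesis
          unfolding U_def N_def \<rho>_def \<tau>_def by simp
      qed
      moreover have "?L + f z s < ?Ut"
      proof -
        have "?L = 2 * N * \<Lambda> + ((4 - 2 * N) * q + (2 * N - 8) * A * (\<tau> / \<rho>)) / \<rho>"
          using D'(2) by (simp add: field_simps power2_eq_square power3_eq_cube)
        moreover have "(4 - 2 * N) * q \<le> 4 + 2 * N"
        proof -
          have "(4 - 2 * N) * q \<le> \<bar>4 - 2 * N\<bar> * \<bar>q\<bar>"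
            by (metis abs_ge_self abs_mult)
          also have "\<dots> \<le> \<bar>4 - 2 * N\<bar> * 1"
            using q by (intro mult_left_mono) auto
          also have "\<dots> \<le> 4 + 2 * N"
            using N by (simp add: abs_le_iff)
          finally show ?thesis .
        qed
        moreover have "(2 * N - 8) * A * (\<tau> / \<rho>) \<le> A / 2"
        proof -
          have "(2 * N - 8) * A * (\<tau> / \<rho>) \<le> 2 * N * A * (\<tau> / \<rho>)"
            using A D'(1,2) by (intro mult_right_mono) auto
          also have "\<dots> = A / 2 * (4 * N * \<tau> / \<rho>)" by simp
          also have "\<dots> \<le> A / 2 * 1"
            using A D'(2,6) by (intro mult_left_mono) auto
          finally show ?thesis by simp
        qed
        moreover have "f z s \<le> A0 / \<rho>"
          using f(1)[OF zD] unfolding \<rho>_def .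
        ultimately have "?L + f z s \<le> 2 * N * \<Lambda> + (4 + 2 * N + A / 2) / \<rho> + A0 / \<rho>"
          using D'(2) divide_right_mono[of "(4 - 2 * N) * q + (2 * N - 8) * A * (\<tau> / \<rho>)"
              "4 + 2 * N + A / 2" \<rho>] by linarith
        also have "\<dots> = 2 * N * \<Lambda> + (A - 1) / \<rho>"
          unfolding A_def by (simp add: add_divide_distrib[symmetric])
        also have "\<dots> < ?Ut"
          using D'(2) by (simp add: divide_strict_right_mono)
        finally show ?thesis .
      qed
      ultimately show "\<exists>Ut L. (U z has_real_derivative Ut) (at s) \<and>
          has_laplacian (\<lambda>y. U y s) L z \<and> L + f z s < Ut"
        by blast
    qed
  qed
  moreover have "U x t \<le> c + 2 * \<epsilon> - 2 * q * ln (norm x) + A / K\<^sup>2 + \<Lambda> * (norm x)\<^sup>2"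
    if xt: "(x, t) \<in> ?D" for x t
  proof -
    have "A * (1 / K\<^sup>2 - (T - t) / (norm x)\<^sup>2) \<le> A * (1 / K\<^sup>2)"
      using A D[OF xt] by (intro mult_left_mono) auto
    moreover have "\<Lambda> * ((norm x)\<^sup>2 - 2 * N * (T - t)) \<le> \<Lambda> * (norm x)\<^sup>2"
      using \<Lambda> N D[OF xt] by (intro mult_left_mono) auto
    moreover have "ln ((norm x)\<^sup>2) = 2 * ln (norm x)"
      using D[OF xt] by (subst ln_realpow) auto
    ultimately show ?thesis unfolding U_def by simp
  qed
  ultimately show ?thesis
    unfolding A_def N_def by (intro exI[of _ \<Lambda>]) fastforce
qed

section \<open>Interior regularity and existence of the limit\<close>

lemma has_laplacian_norm_square:
  fixes x p :: "'a::euclidean_space"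
  shows "has_laplacian (\<lambda>z. (norm (z - p))\<^sup>2) (2 * real DIM('a)) x"
proof -
  have "has_laplacian (\<lambda>z. (norm (z - p))\<^sup>2)
      (2 * real DIM('a) * 1 + 4 * (norm (x - p))\<^sup>2 * 0) x"
    by (rule has_laplacian_radial[where G = "\<lambda>r. r"]) (auto intro: always_eventually)
  then show ?thesis by simp
qed

lemma reflect_fixed: "(x - q) \<bullet> b = 0 \<Longrightarrow> reflect q b x = x"
  unfolding reflect_def by simp

lemma dist_reflect:
  assumes "b \<in> Basis"
  shows "dist q (reflect q b x) = dist q x"
proof -
  define y where "y = x - q"
  have eq: "reflect q b x - q = y - (2 * (y \<bullet> b)) *\<^sub>R b"
    unfolding reflect_def y_def by simp
  have "(norm (reflect q b x - q))\<^sup>2 = (norm y)\<^sup>2"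
    unfolding eq power2_norm_eq_inner using assms
    by (simp add: inner_diff_left inner_diff_right inner_commute[of b y] algebra_simps)
  then have "norm (reflect q b x - q) = norm y"
    by simp
  then show ?thesis
    unfolding y_def by (simp add: dist_norm norm_minus_commute)
qed

lemma continuous_on_reflect [continuous_intros]:
  assumes "continuous_on S g"
  shows "continuous_on S (\<lambda>x. reflect q b (g x))"
  unfolding reflect_def using assms by (intro continuous_intros)

text \<open>The difference \<open>u - u \<circ> R\<close> of the solution and its reflection solves a heat equation with bounded
  source and vanishes on the mirror. After multiplication by \<open>t - t0\<close> it also vanishes at the
  initial time, and can be compared with a barrier that grows linearly in the distance \<open>\<sigma>\<close> to the
  mirror: \<open>- \<beta> \<sigma>\<^sup>2\<close> absorbs the source and \<open>c \<bar>x - q\<bar>\<^sup>2\<close> the values on the sphere.\<close>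
lemma reflection_estimate:
  fixes u :: "'a::euclidean_space \<Rightarrow> real \<Rightarrow> real"
  assumes r: "0 < r" and b: "b \<in> Basis"
    and heat: "solves_heat (cball q r \<times> {t0..<T}) u f"
    and u_le: "\<And>x t. x \<in> cball q r \<Longrightarrow> t \<in> {t0..<T} \<Longrightarrow> \<bar>u x t\<bar> \<le> m"
    and f_le: "\<And>x t. x \<in> cball q r \<Longrightarrow> t \<in> {t0..<T} \<Longrightarrow> \<bar>f x t\<bar> \<le> m'"
    and t: "t \<in> {t0..<T}" and h: "0 \<le> h" "h \<le> r"
    and c: "c = 2 * m * (T - t0) / r\<^sup>2" and \<beta>: "\<beta> = real DIM('a) * c + m + m' * (T - t0) + 1"
  shows "(t - t0) * (u (q + h *\<^sub>R b) t - u (q - h *\<^sub>R b) t) \<le> (\<beta> + c) * r * h"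
proof -
  define N where "N = real DIM('a)"
  define R where "R = reflect q b"
  define Y where "Y = (\<lambda>x t. (t - t0) * (u x t - u (R x) t))"
  define F where "F = (\<lambda>x t. (u x t - u (R x) t) + (t - t0) * (f x t - f (R x) t))"
  define S where "S = {x \<in> cball q r. 0 \<le> (x - q) \<bullet> b} \<times> {t0..t}"
  have m: "0 \<le> m" "0 \<le> m'"
    using u_le[of q t] f_le[of q t] t r by auto
  have cn: "0 \<le> c"
    using m t unfolding c by simp
  then have "0 \<le> real DIM('a) * c" "0 \<le> m' * (T - t0)"
    using m t by simp_all
  then have \<beta>_pos: "0 < \<beta>"
    unfolding \<beta> using m by linarith
  have RS: "R x \<in> cball q r" if "x \<in> cball q r" for x
    using that dist_reflect[OF b] unfolding R_def by simp
  have heatR: "solves_heat S Y F"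
    unfolding solves_heat_def
  proof (intro conjI ballI; clarify?)
    have cont: "continuous_on (cball q r \<times> {t0..<T}) (\<lambda>(x, t). u x t)"
      using heat unfolding solves_heat_def by simp
    have "continuous_on S (\<lambda>P. (\<lambda>(x, t). u x t) (fst P, snd P))"
      by (rule continuous_on_compose2[OF cont])
        (use t in \<open>auto simp: S_def intro!: continuous_intros\<close>)
    moreover have "continuous_on S (\<lambda>P. (\<lambda>(x, t). u x t) (R (fst P), snd P))"
      unfolding R_def
      by (rule continuous_on_compose2[OF cont])
        (use t RS in \<open>auto simp: S_def R_def intro!: continuous_intros\<close>)
    ultimately show "continuous_on S (\<lambda>(x, t). Y x t)"
      unfolding Y_def case_prod_unfold by (intro continuous_intros) auto
    fix x s assume "(x, s) \<in> S"
    then have x: "x \<in> cball q r" "R x \<in> cball q r" and s: "s \<in> {t0..<T}"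
      using RS t unfolding S_def by auto
    obtain L where L: "(u x has_real_derivative (L + f x s)) (at s)" "has_laplacian (\<lambda>z. u z s) L x"
      using heat x s unfolding solves_heat_def by blast
    obtain M where M: "(u (R x) has_real_derivative (M + f (R x) s)) (at s)"
        "has_laplacian (\<lambda>z. u z s) M (R x)"
      using heat x s unfolding solves_heat_def by blast
    have "has_laplacian (\<lambda>z. u (R z) s) M x"
      unfolding R_def by (rule has_laplacian_reflect[OF b]) (use M(2) in \<open>simp add: R_def\<close>)
    then have "has_laplacian (\<lambda>z. Y z s) ((s - t0) * (L - M)) x"
      unfolding Y_def by (intro has_laplacian_cmult has_laplacian_diff L(2))
    moreover have "(Y x has_real_derivative (s - t0) * (L - M) + F x s) (at s)"
      unfolding Y_def F_def
      by (auto intro!: derivative_eq_intros L(1) M(1) simp: algebra_simps)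
    ultimately show "\<exists>L. (Y x has_real_derivative (L + F x s)) (at s) \<and> has_laplacian (\<lambda>z. Y z s) L x"
      by blast
  qed
  have Y_less: "Y x t < \<epsilon> + (\<beta> * r * ((x - q) \<bullet> b) - \<beta> * ((x - q) \<bullet> b)\<^sup>2) + c * (norm (x - q))\<^sup>2"
    if \<epsilon>: "0 < \<epsilon>" and xt: "(x, t) \<in> S" for \<epsilon> x
  proof -
    define U where "U = (\<lambda>x (t::real). \<epsilon> + (\<beta> * r * ((x - q) \<bullet> b) - \<beta> * ((x - q) \<bullet> b)\<^sup>2) +
      c * (norm (x - q))\<^sup>2)"
    have "Y x t < U x t"
    proof (rule heat_comparison[where S = S and u = Y and U = U and f = F])
      show "compact S"
      proof -
        have "S = (cball q r \<inter> {x. 0 \<le> (x - q) \<bullet> b}) \<times> {t0..t}"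
          unfolding S_def by auto
        moreover have "closed {x. 0 \<le> (x - q) \<bullet> b}"
          by (intro closed_Collect_le continuous_intros)
        ultimately show ?thesis
          by (simp add: compact_Times compact_Int_closed)
      qed
      show "solves_heat S Y F" by (rule heatR)
      show "(x, t) \<in> S" by (rule xt)
      show "continuous_on S (\<lambda>(x, t). U x t)"
        unfolding U_def case_prod_unfold by (intro continuous_intros)
      fix x s assume xs: "(x, s) \<in> S"
      then have x: "x \<in> cball q r" "0 \<le> (x - q) \<bullet> b" and s: "s \<in> {t0..<T}" "s \<le> t"
        using t unfolding S_def by auto
      define \<sigma> where "\<sigma> = (x - q) \<bullet> b"
      have "\<bar>\<sigma>\<bar> \<le> norm (x - q)"
        unfolding \<sigma>_def using Cauchy_Schwarz_ineq2[of "x - q" b] b by simp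
      then have \<sigma>: "0 \<le> \<sigma>" "\<sigma> \<le> r"
        using x unfolding \<sigma>_def by (auto simp: dist_norm norm_minus_commute)
      have parab: "0 \<le> \<beta> * r * \<sigma> - \<beta> * \<sigma>\<^sup>2"
        using mult_left_mono[OF \<sigma>(2), of "\<beta> * \<sigma>"] \<beta>_pos \<sigma>(1) by (simp add: power2_eq_square mult_ac)
      have Ux: "U x s = \<epsilon> + (\<beta> * r * \<sigma> - \<beta> * \<sigma>\<^sup>2) + c * (norm (x - q))\<^sup>2"
        unfolding U_def \<sigma>_def ..
      have bounds: "\<bar>u x s\<bar> \<le> m" "\<bar>u (R x) s\<bar> \<le> m" "\<bar>f x s\<bar> \<le> m'" "\<bar>f (R x) s\<bar> \<le> m'"
        using u_le f_le x(1) RS s by auto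
      have scale: "(s - t0) * z \<le> (T - t0) * (2 * w)" if "z \<le> 2 * w" "0 \<le> w" for z w
        using mult_left_mono[OF that(1), of "s - t0"] mult_right_mono[of "s - t0" "T - t0" "2 * w"]
          s that(2) by simp
      show "Y x s < U x s" if not_int: "\<not> parabolic_interior S x s"
      proof -
        have "\<not> (dist q x < r \<and> 0 < \<sigma> \<and> t0 < s)"
        proof
          assume strict: "dist q x < r \<and> 0 < \<sigma> \<and> t0 < s"
          have "parabolic_interior S x s"
          proof (rule parabolic_interior_open)
            let ?W = "(ball q r \<inter> {x. 0 < (x - q) \<bullet> b}) \<times> {t0<..}"
            show "open ?W"
              by (intro open_Times open_Int open_ball open_greaterThan open_Collect_less continuous_intros)
            show "(x, s) \<in> ?W" using strict unfolding \<sigma>_def by simp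
            show "(y, s') \<in> S" if "(y, s') \<in> ?W" "s' \<le> s" for y s'
              using that s unfolding S_def by auto
          qed
          with not_int show False ..
        qed
        then consider "dist q x = r" | "\<sigma> = 0" | "s = t0"
          using x \<sigma>(1) s by fastforce
        then show ?thesis
        proof cases
          case 1
          have "Y x s \<le> (T - t0) * (2 * m)"
            unfolding Y_def using bounds m by (intro scale) auto
          also have "\<dots> = c * (norm (x - q))\<^sup>2"
            using 1 r unfolding c by (simp add: dist_norm norm_minus_commute)
          finally show ?thesis using parab \<epsilon> unfolding Ux by linarith
        next
          case 2
          then have "Y x s = 0"
            unfolding Y_def R_def \<sigma>_def by (simp add: reflect_fixed)
          then show ?thesis using parab \<epsilon> cn unfolding Ux by (simp add: add_pos_nonneg)
        next
          case 3
          then have "Y x s = 0" unfolding Y_def by simp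
          then show ?thesis using parab \<epsilon> cn unfolding Ux by (simp add: add_pos_nonneg)
        qed
      qed
      have "(U x has_real_derivative 0) (at s)"
        unfolding U_def by simp
      moreover have "has_laplacian (\<lambda>z. U z s) (2 * N * c - 2 * \<beta>) x"
      proof -
        have "has_laplacian (\<lambda>z. \<beta> * r * ((z - q) \<bullet> b) - \<beta> * ((z - q) \<bullet> b)\<^sup>2) (- 2 * \<beta>) x"
        proof (rule has_laplacian_coordinate[OF b,
              where G = "\<lambda>\<sigma>. \<beta> * r * \<sigma> - \<beta> * \<sigma>\<^sup>2"])
          have "((\<lambda>\<sigma>. \<beta> * r * \<sigma> - \<beta> * \<sigma>\<^sup>2) has_real_derivative \<beta> * r - 2 * \<beta> * \<sigma>)
              (at \<sigma>)" for \<sigma>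
            by (auto intro!: derivative_eq_intros)
          then show "\<forall>\<^sub>F \<sigma> in nhds ((x - q) \<bullet> b).
              ((\<lambda>\<sigma>. \<beta> * r * \<sigma> - \<beta> * \<sigma>\<^sup>2) has_real_derivative \<beta> * r - 2 * \<beta> * \<sigma>) (at \<sigma>)"
            by simp
          show "((\<lambda>\<sigma>. \<beta> * r - 2 * \<beta> * \<sigma>) has_real_derivative - 2 * \<beta>) (at ((x - q) \<bullet> b))"
            by (auto intro!: derivative_eq_intros)
        qed
        from has_laplacian_add[OF has_laplacian_add[OF has_laplacian_const[of \<epsilon>] this]
            has_laplacian_cmult[OF has_laplacian_norm_square[of q], of c]]
        show ?thesis
          unfolding U_def N_def by (simp add: mult_ac)
      qed
      moreover have "(2 * N * c - 2 * \<beta>) + F x s < 0"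
      proof -
        have "(s - t0) * (f x s - f (R x) s) \<le> (T - t0) * (2 * m')"
          using bounds m by (intro scale) auto
        then have "F x s \<le> 2 * m + (T - t0) * (2 * m')"
          unfolding F_def using bounds by simp
        then show ?thesis unfolding \<beta> N_def by (simp add: algebra_simps)
      qed
      ultimately show "\<exists>Ut L. (U x has_real_derivative Ut) (at s) \<and>
          has_laplacian (\<lambda>z. U z s) L x \<and> L + F x s < Ut"
        by blast
    qed
    then show ?thesis unfolding U_def .
  qed
  define x where "x = q + h *\<^sub>R b"
  have xb: "(x - q) \<bullet> b = h" "norm (x - q) = h"
    using b h unfolding x_def by auto
  have xS: "(x, t) \<in> S"
    using h t xb unfolding S_def by (auto simp: dist_norm norm_minus_commute)
  have Rx: "R x = q - h *\<^sub>R b"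
    unfolding R_def reflect_def xb(1) mult_2 scaleR_add_left unfolding x_def by simp
  have hh: "h\<^sup>2 \<le> r * h"
    using h by (simp add: power2_eq_square mult_right_mono)
  have "(t - t0) * (u (q + h *\<^sub>R b) t - u (q - h *\<^sub>R b) t) \<le> (\<beta> + c) * r * h + \<epsilon>" if "0 < \<epsilon>" for \<epsilon>
  proof -
    have "Y x t < \<epsilon> + (\<beta> * r * h - \<beta> * h\<^sup>2) + c * h\<^sup>2"
      using Y_less[OF that xS] unfolding xb .
    also have "\<dots> \<le> \<epsilon> + \<beta> * r * h + c * (r * h)"
      using mult_left_mono[OF hh cn] mult_nonneg_nonneg[OF less_imp_le[OF \<beta>_pos] zero_le_power2[of h]]
      by linarith
    finally show ?thesis unfolding Y_def Rx unfolding x_def by (simp add: algebra_simps)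
  qed
  then show ?thesis by (rule field_le_epsilon)
qed

text \<open>Walk from \<open>p\<close> to \<open>x\<close> changing one coordinate at a time; the assumption on \<open>x\<close> keeps the path
  inside the ball.\<close>
lemma coordinate_steps_imp_lipschitz:
  fixes g :: "'a::euclidean_space \<Rightarrow> real"
  assumes C: "0 \<le> C"
    and step: "\<And>x b h. x \<in> cball p r \<Longrightarrow> x + h *\<^sub>R b \<in> cball p r \<Longrightarrow> b \<in> Basis \<Longrightarrow>
      \<bar>g (x + h *\<^sub>R b) - g x\<bar> \<le> C * \<bar>h\<bar>"
    and x: "real DIM('a) * norm (x - p) \<le> r"
  shows "\<bar>g x - g p\<bar> \<le> C * real DIM('a) * norm (x - p)"
proof -
  define k where "k = (\<lambda>b. (x - p) \<bullet> b)"
  have sum_le: "(\<Sum>b\<in>B. \<bar>k b\<bar>) \<le> real DIM('a) * norm (x - p)" if "B \<subseteq> Basis" for B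
  proof -
    have "(\<Sum>b\<in>B. \<bar>k b\<bar>) \<le> (\<Sum>b\<in>Basis. \<bar>k b\<bar>)"
      using that by (intro sum_mono2) auto
    also have "\<dots> \<le> (\<Sum>b\<in>(Basis::'a set). norm (x - p))"
      unfolding k_def by (intro sum_mono Basis_le_norm)
    finally show ?thesis by simp
  qed
  have mem: "p + (\<Sum>b\<in>B. k b *\<^sub>R b) \<in> cball p r" if "B \<subseteq> Basis" for B
  proof -
    have "norm (\<Sum>b\<in>B. k b *\<^sub>R b) \<le> (\<Sum>b\<in>B. \<bar>k b\<bar>)"
      using that by (intro sum_norm_le) (auto simp: subset_eq)
    with sum_le[OF that] x show ?thesis by (simp add: dist_norm)
  qed
  have "\<bar>g (p + (\<Sum>b\<in>B. k b *\<^sub>R b)) - g p\<bar> \<le> C * (\<Sum>b\<in>B. \<bar>k b\<bar>)" if "finite B" "B \<subseteq> Basis" for B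
    using that
  proof (induction B rule: finite_induct)
    case (insert b B)
    let ?y = "p + (\<Sum>b\<in>B. k b *\<^sub>R b)"
    have y: "p + (\<Sum>b\<in>insert b B. k b *\<^sub>R b) = ?y + k b *\<^sub>R b"
      using insert.hyps by (simp add: add_ac)
    have "\<bar>g (?y + k b *\<^sub>R b) - g ?y\<bar> \<le> C * \<bar>k b\<bar>"
      using mem[of B] mem[of "insert b B"] insert.prems unfolding y by (intro step) auto
    then show ?case
      using insert unfolding y by (simp add: distrib_left)
  qed simp
  from this[of Basis] have "\<bar>g (p + (x - p)) - g p\<bar> \<le> C * (\<Sum>b\<in>Basis. \<bar>k b\<bar>)"
    unfolding k_def euclidean_representation by simp
  also have "\<dots> \<le> C * (real DIM('a) * norm (x - p))"
    using sum_le[of Basis] C by (intro mult_left_mono) auto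
  finally show ?thesis by (simp add: mult_ac)
qed

text \<open>Two points on a line parallel to a basis vector are mirror images with respect to the hyperplane
  through their midpoint. The constant does not deteriorate as \<open>t\<close> approaches \<open>T\<close>.\<close>
lemma heat_interior_lipschitz:
  fixes u :: "'a::euclidean_space \<Rightarrow> real \<Rightarrow> real"
  assumes r: "0 < r" and t01: "t0 < t1" "t1 < T"
    and heat: "solves_heat (cball p (2 * r) \<times> {t0..<T}) u f"
    and u_le: "\<And>x t. x \<in> cball p (2 * r) \<Longrightarrow> t \<in> {t0..<T} \<Longrightarrow> \<bar>u x t\<bar> \<le> m"
    and f_le: "\<And>x t. x \<in> cball p (2 * r) \<Longrightarrow> t \<in> {t0..<T} \<Longrightarrow> \<bar>f x t\<bar> \<le> m'"
  obtains L where "0 \<le> L" "\<And>x t. real DIM('a) * norm (x - p) \<le> r \<Longrightarrow> t \<in> {t1..<T} \<Longrightarrow>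
    \<bar>u x t - u p t\<bar> \<le> L * norm (x - p)"
proof -
  define c where "c = 2 * m * (T - t0) / r\<^sup>2"
  define \<beta> where "\<beta> = real DIM('a) * c + m + m' * (T - t0) + 1"
  define C where "C = (\<beta> + c) * r / (2 * (t1 - t0))"
  have m: "0 \<le> m" "0 \<le> m'"
    using u_le[of p t0] f_le[of p t0] t01 r by auto
  have C: "0 \<le> C" "0 \<le> (\<beta> + c) * r"
    using m t01 r unfolding C_def \<beta>_def c_def by simp_all
  have half: "\<bar>u (q + h *\<^sub>R b) t - u (q - h *\<^sub>R b) t\<bar> \<le> C * (2 * h)"
    if q: "q \<in> cball p r" and b: "b \<in> Basis" and h: "0 \<le> h" "h \<le> r" and t: "t \<in> {t1..<T}" for q b h t
  proof -
    have sub: "x \<in> cball p (2 * r)" if "x \<in> cball q r" for x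
      using that q dist_triangle[of p x q] by simp
    have heat_q: "solves_heat (cball q r \<times> {t0..<T}) u f"
      by (rule solves_heat_subset[OF heat]) (use sub in auto)
    have t': "t \<in> {t0..<T}" using t t01 by auto
    have "(t - t0) * (u (q + h *\<^sub>R b) t - u (q - h *\<^sub>R b) t) \<le> (\<beta> + c) * r * h"
      by (rule reflection_estimate[OF r b heat_q _ _ t' h c_def \<beta>_def]) (use u_le f_le sub in auto)
    moreover have "(t - t0) * (- u (q + h *\<^sub>R b) t - - u (q - h *\<^sub>R b) t) \<le> (\<beta> + c) * r * h"
      by (rule reflection_estimate[OF r b solves_heat_minus[OF heat_q] _ _ t' h c_def \<beta>_def])
        (use u_le f_le sub in auto)
    moreover have "(t - t0) * (- u (q + h *\<^sub>R b) t - - u (q - h *\<^sub>R b) t) =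
        - ((t - t0) * (u (q + h *\<^sub>R b) t - u (q - h *\<^sub>R b) t))"
      by (simp add: algebra_simps)
    ultimately have "\<bar>(t - t0) * (u (q + h *\<^sub>R b) t - u (q - h *\<^sub>R b) t)\<bar> \<le> (\<beta> + c) * r * h"
      by linarith
    then have "(t - t0) * \<bar>u (q + h *\<^sub>R b) t - u (q - h *\<^sub>R b) t\<bar> \<le> (\<beta> + c) * r * h"
      using t' by (simp add: abs_mult)
    moreover have "(t1 - t0) * \<bar>u (q + h *\<^sub>R b) t - u (q - h *\<^sub>R b) t\<bar> \<le>
        (t - t0) * \<bar>u (q + h *\<^sub>R b) t - u (q - h *\<^sub>R b) t\<bar>"
      using t by (intro mult_right_mono) auto
    moreover have "(\<beta> + c) * r * h = (t1 - t0) * (C * (2 * h))"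
      unfolding C_def using t01 by (simp add: field_simps)
    ultimately show ?thesis
      using t01 by (metis (no_types, lifting) diff_gt_0_iff_gt mult_le_cancel_left_pos order_trans)
  qed
  have step: "\<bar>u (x + h *\<^sub>R b) t - u x t\<bar> \<le> C * \<bar>h\<bar>"
    if x: "x \<in> cball p r" "x + h *\<^sub>R b \<in> cball p r" and b: "b \<in> Basis" and t: "t \<in> {t1..<T}"
    for x h b t
  proof -
    define q where "q = x + (h / 2) *\<^sub>R b"
    have "q = (1 / 2) *\<^sub>R x + (1 / 2) *\<^sub>R (x + h *\<^sub>R b)"
    proof -
      have "(1 / 2) *\<^sub>R x + (1 / 2) *\<^sub>R x = x"
        by (simp flip: scaleR_add_left)
      then show ?thesis
        unfolding q_def scaleR_add_right add.assoc[symmetric] by simp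
    qed
    then have q: "q \<in> cball p r"
      using convexD[OF convex_cball x, of "1 / 2" "1 / 2"] by simp
    have "norm (h *\<^sub>R b) \<le> dist p (x + h *\<^sub>R b) + dist p x"
      using dist_triangle3[of "x + h *\<^sub>R b" x p] by (simp add: dist_norm)
    then have h: "\<bar>h\<bar> / 2 \<le> r" using x b by simp
    have ends: "q + (h / 2) *\<^sub>R b = x + h *\<^sub>R b" "q - (h / 2) *\<^sub>R b = x"
      unfolding q_def by (simp_all add: add.assoc flip: scaleR_add_left)
    show ?thesis
    proof (cases "0 \<le> h")
      case True
      then show ?thesis
        using half[OF q b, of "h / 2" t] h t ends by simp
    next
      case False
      then show ?thesis
        using half[OF q b, of "- h / 2" t] h t ends by (simp add: abs_minus_commute)
    qed
  qed
  show ?thesis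
  proof (rule that[of "C * real DIM('a)"])
    show "0 \<le> C * real DIM('a)" using C by simp
    show "\<bar>u x t - u p t\<bar> \<le> C * real DIM('a) * norm (x - p)"
      if "real DIM('a) * norm (x - p) \<le> r" "t \<in> {t1..<T}" for x t
      by (rule coordinate_steps_imp_lipschitz[where g = "\<lambda>x. u x t", OF C(1) step that(1)])
        (use that(2) in auto)
  qed
qed

text \<open>The Lipschitz cone at the initial time lies below the paraboloid
  \<open>\<epsilon> / 2 + L\<^sup>2 / (2 \<epsilon>) \<bar>x - p\<bar>\<^sup>2\<close>, whose caloric extension grows at a finite rate.\<close>
lemma heat_upper_bound_forward_in_time:
  fixes v :: "'a::euclidean_space \<Rightarrow> real \<Rightarrow> real"
  assumes r: "0 < r"
    and heat: "solves_heat (cball p r \<times> {t0..<T}) v f"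
    and v_le: "\<And>x t. x \<in> cball p r \<Longrightarrow> t \<in> {t0..<T} \<Longrightarrow> \<bar>v x t\<bar> \<le> m"
    and f_le: "\<And>x t. x \<in> cball p r \<Longrightarrow> t \<in> {t0..<T} \<Longrightarrow> f x t \<le> m'"
    and start: "\<And>x. x \<in> cball p r \<Longrightarrow> v x t0 \<le> v p t0 + L * norm (x - p)"
    and \<epsilon>: "0 < \<epsilon>" and m': "0 \<le> m'"
    and t: "t \<in> {t0..<T}"
  shows "v p t \<le> v p t0 + \<epsilon> +
    (2 * real DIM('a) * (L\<^sup>2 / (2 * \<epsilon>) + 2 * m / r\<^sup>2) + m' + 1) * (t - t0)"
proof -
  define c where "c = L\<^sup>2 / (2 * \<epsilon>) + 2 * m / r\<^sup>2"
  define \<kappa> where "\<kappa> = 2 * real DIM('a) * c + m' + 1"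
  define U where "U = (\<lambda>x t. v p t0 + \<epsilon> + \<kappa> * (t - t0) + c * (norm (x - p))\<^sup>2)"
  have m: "0 \<le> m" using v_le[of p t] t r by auto
  have c: "0 \<le> c" "L\<^sup>2 / (2 * \<epsilon>) \<le> c" "2 * m / r\<^sup>2 \<le> c"
    unfolding c_def using m \<epsilon> by auto
  have \<kappa>: "0 \<le> \<kappa>" unfolding \<kappa>_def using c m' by simp
  have "v p t < U p t"
  proof (rule heat_comparison[where S = "cball p r \<times> {t0..t}" and u = v and U = U and f = f])
    let ?S = "cball p r \<times> {t0..t}"
    show "compact ?S" by (intro compact_Times) auto
    show "solves_heat ?S v f"
      using t by (intro solves_heat_subset[OF heat]) auto
    show "(p, t) \<in> ?S" using r t by auto
    show "continuous_on ?S (\<lambda>(x, t). U x t)"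
      unfolding U_def case_prod_unfold by (intro continuous_intros)
    fix x s assume xs: "(x, s) \<in> ?S"
    then have s: "s \<in> {t0..<T}" "s \<le> t" and x: "x \<in> cball p r"
      using t by auto
    show "v x s < U x s" if not_int: "\<not> parabolic_interior ?S x s"
    proof (cases "s = t0")
      case True
      \<comment> \<open>Young's inequality\<close>
      have "L * d \<le> \<epsilon> / 2 + L\<^sup>2 / (2 * \<epsilon>) * d\<^sup>2" for d
      proof -
        have "\<epsilon> / 2 + L\<^sup>2 / (2 * \<epsilon>) * d\<^sup>2 - L * d = (\<epsilon> - L * d)\<^sup>2 / (2 * \<epsilon>)"
          using \<epsilon> by (simp add: field_simps power2_eq_square)
        also have "\<dots> \<ge> 0" using \<epsilon> by simp
        finally show ?thesis by simp
      qed
      from this[of "norm (x - p)"] have "L * norm (x - p) \<le> \<epsilon> / 2 + c * (norm (x - p))\<^sup>2"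
        using mult_right_mono[OF c(2), of "(norm (x - p))\<^sup>2"] by simp
      then show ?thesis
        using start[OF x] True \<epsilon> unfolding U_def by simp
    next
      case False
      then have "dist p x = r"
        using parabolic_interior_cylinder[of p x r t0 s t] not_int x s by force
      then have "(norm (x - p))\<^sup>2 = r\<^sup>2"
        by (simp only: dist_norm norm_minus_commute)
      then have "2 * m \<le> c * (norm (x - p))\<^sup>2"
        using c(3) r by (simp add: field_simps)
      moreover have "v x s \<le> m" "- m \<le> v p t0"
        using v_le[OF x s(1)] v_le[of p t0] r t by auto
      moreover have "0 \<le> \<kappa> * (s - t0)" using \<kappa> s by simp
      ultimately show ?thesis using \<epsilon> unfolding U_def by linarith
    qed
    have "(U x has_real_derivative \<kappa>) (at s)"
      unfolding U_def by (auto intro!: derivative_eq_intros)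
    moreover have "has_laplacian (\<lambda>z. U z s) (2 * real DIM('a) * c) x"
      using has_laplacian_add[OF has_laplacian_const has_laplacian_cmult[OF has_laplacian_norm_square]]
      unfolding U_def by (simp add: mult_ac)
    moreover have "2 * real DIM('a) * c + f x s < \<kappa>"
      using f_le[OF x s(1)] unfolding \<kappa>_def by simp
    ultimately show "\<exists>Ut L. (U x has_real_derivative Ut) (at s) \<and>
        has_laplacian (\<lambda>z. U z s) L x \<and> L + f x s < Ut"
      by blast
  qed
  then show ?thesis unfolding U_def \<kappa>_def c_def by simp
qed

lemma Cauchy_at_left_imp_convergent:
  fixes g :: "real \<Rightarrow> real"
  assumes "\<And>\<epsilon>. 0 < \<epsilon> \<Longrightarrow> \<exists>s<T. \<forall>t\<in>{s..<T}. \<bar>g t - g s\<bar> \<le> \<epsilon>"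
  shows "\<exists>l. (g \<longlongrightarrow> l) (at_left T)"
proof -
  have osc: "\<exists>s<T. \<forall>t\<in>{s..<T}. \<forall>t'\<in>{s..<T}. \<bar>g t - g t'\<bar> < e" if "0 < e" for e
  proof -
    obtain s where s: "s < T" "\<forall>t\<in>{s..<T}. \<bar>g t - g s\<bar> \<le> e / 3"
      using assms[of "e / 3"] \<open>0 < e\<close> by auto
    then have "\<bar>g t - g t'\<bar> < e" if "t \<in> {s..<T}" "t' \<in> {s..<T}" for t t'
      using bspec[OF s(2) that(1)] bspec[OF s(2) that(2)] \<open>0 < e\<close> by linarith
    then show ?thesis using s(1) by blast
  qed
  define X where "X = (\<lambda>n. T - inverse (real (Suc n)))"
  have X_lim: "X \<longlonglongrightarrow> T"
    unfolding X_def using tendsto_diff[OF tendsto_const LIMSEQ_inverse_real_of_nat] by simp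
  have X_less: "X n < T" for n unfolding X_def by simp
  have X_ev: "\<forall>\<^sub>F n in sequentially. X n \<in> {s..<T}" if "s < T" for s
    using order_tendstoD(1)[OF X_lim that] by eventually_elim (use X_less in \<open>auto intro: less_imp_le\<close>)
  have "Cauchy (\<lambda>n. g (X n))"
    unfolding Cauchy_def dist_real_def
  proof (intro allI impI)
    fix e :: real assume "0 < e"
    then obtain s where s: "s < T" "\<forall>t\<in>{s..<T}. \<forall>t'\<in>{s..<T}. \<bar>g t - g t'\<bar> < e"
      using osc by blast
    then show "\<exists>M. \<forall>m\<ge>M. \<forall>n\<ge>M. \<bar>g (X m) - g (X n)\<bar> < e"
      using X_ev[OF s(1)] unfolding eventually_sequentially by blast
  qed
  then obtain l where l: "(\<lambda>n. g (X n)) \<longlonglongrightarrow> l"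
    using Cauchy_convergent convergent_def by blast
  have "(g \<longlongrightarrow> l) (at_left T)"
    unfolding tendsto_iff dist_real_def
  proof (intro allI impI)
    fix e :: real assume "0 < e"
    then obtain s where s: "s < T" "\<forall>t\<in>{s..<T}. \<forall>t'\<in>{s..<T}. \<bar>g t - g t'\<bar> < e / 2"
      using osc[of "e / 2"] by auto
    have "\<forall>\<^sub>F n in sequentially. \<bar>g (X n) - l\<bar> < e / 2"
      using tendstoD[OF l, of "e / 2"] \<open>0 < e\<close> unfolding dist_real_def by simp
    then obtain n where n: "\<bar>g (X n) - l\<bar> < e / 2" "X n \<in> {s..<T}"
      using eventually_happens'[OF sequentially_bot eventually_conj[OF _ X_ev[OF s(1)]]] by blast
    have "\<bar>g t - l\<bar> < e" if "s < t" "t < T" for t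
    proof -
      have "\<bar>g t - g (X n)\<bar> < e / 2" using s(2) n(2) that by auto
      with n(1) show ?thesis by linarith
    qed
    then show "\<forall>\<^sub>F t in at_left T. \<bar>g t - l\<bar> < e"
      unfolding eventually_at_left[OF s(1)] using s(1) by blast
  qed
  then show ?thesis by blast
qed

text \<open>Bounding \<open>u p\<close> and \<open>- u p\<close> forward in time, from a starting time close to \<open>T\<close>, is Cauchy's
  criterion at \<open>T\<close>: the Lipschitz constant, and with it the rate \<open>\<kappa>\<close>, can be chosen before the
  starting time.\<close>
lemma bounded_heat_solution_has_limit:
  fixes u :: "'a::euclidean_space \<Rightarrow> real \<Rightarrow> real"
  assumes r: "0 < r" and t0: "t0 < T"
    and heat: "solves_heat (cball p (2 * r) \<times> {t0..<T}) u f"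
    and u_le: "\<And>x t. x \<in> cball p (2 * r) \<Longrightarrow> t \<in> {t0..<T} \<Longrightarrow> \<bar>u x t\<bar> \<le> m"
    and f_le: "\<And>x t. x \<in> cball p (2 * r) \<Longrightarrow> t \<in> {t0..<T} \<Longrightarrow> \<bar>f x t\<bar> \<le> m'"
  shows "\<exists>l. (u p \<longlongrightarrow> l) (at_left T)"
proof (rule Cauchy_at_left_imp_convergent)
  fix \<epsilon> :: real assume \<epsilon>: "0 < \<epsilon>"
  define N where "N = real DIM('a)"
  define t1 where "t1 = (t0 + T) / 2"
  have t1: "t0 < t1" "t1 < T" using t0 unfolding t1_def by auto
  have N: "1 \<le> N" unfolding N_def using DIM_positive[where 'a = 'a] by simp
  have m: "0 \<le> m" "0 \<le> m'"
    using u_le[of p t0] f_le[of p t0] t0 r by auto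
  obtain L where L: "0 \<le> L" "\<And>x t. N * norm (x - p) \<le> r \<Longrightarrow> t \<in> {t1..<T} \<Longrightarrow>
      \<bar>u x t - u p t\<bar> \<le> L * norm (x - p)"
    unfolding N_def
    using heat_interior_lipschitz[OF r t1 heat u_le f_le] by blast
  define r' where "r' = r / N"
  define \<kappa> where "\<kappa> = 2 * N * (L\<^sup>2 / (2 * (\<epsilon> / 2)) + 2 * m / r'\<^sup>2) + m' + 1"
  have r': "0 < r'" "r' \<le> 2 * r"
    using r N unfolding r'_def by (auto simp: field_simps intro: order_trans[of _ "2 * r * 1"])
  have sub: "x \<in> cball p (2 * r)" if "x \<in> cball p r'" for x
    using that r' by auto
  have "0 < \<kappa>"
    unfolding \<kappa>_def using N m \<epsilon> by (intro add_nonneg_pos add_nonneg_nonneg mult_nonneg_nonneg) auto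
  define s where "s = max t1 (T - \<epsilon> / (2 * \<kappa>))"
  have s: "t1 \<le> s" "s < T" "\<kappa> * (T - s) \<le> \<epsilon> / 2"
    using t1 \<epsilon> \<open>0 < \<kappa>\<close> unfolding s_def by (auto simp: field_simps max_def)
  have heat_s: "solves_heat (cball p r' \<times> {s..<T}) u f"
    by (rule solves_heat_subset[OF heat]) (use sub s t1 in auto)
  have start: "\<bar>u x s - u p s\<bar> \<le> L * norm (x - p)" if "x \<in> cball p r'" for x
  proof (rule L(2))
    show "N * norm (x - p) \<le> r"
      using that N unfolding r'_def by (simp add: dist_norm norm_minus_commute field_simps)
  qed (use s in auto)
  have "\<bar>u p t - u p s\<bar> \<le> \<epsilon>" if t: "t \<in> {s..<T}" for t
  proof -
    have bounds: "\<bar>u x t\<bar> \<le> m" "\<bar>f x t\<bar> \<le> m'" if "x \<in> cball p r'" "t \<in> {s..<T}" for x t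
      using u_le f_le sub that s t1 by auto
    have "u p t \<le> u p s + \<epsilon> / 2 + \<kappa> * (t - s)"
      unfolding \<kappa>_def N_def
    proof (rule heat_upper_bound_forward_in_time[OF r'(1) heat_s])
      show "f x t \<le> m'" if "x \<in> cball p r'" "t \<in> {s..<T}" for x t
        using bounds(2)[OF that] by simp
      show "u x s \<le> u p s + L * norm (x - p)" if "x \<in> cball p r'" for x
        using start[OF that] by simp
    qed (use bounds \<epsilon> m t in auto)
    moreover have "- u p t \<le> - u p s + \<epsilon> / 2 + \<kappa> * (t - s)"
      unfolding \<kappa>_def N_def
    proof (rule heat_upper_bound_forward_in_time[OF r'(1) solves_heat_minus[OF heat_s]])
      show "- f x t \<le> m'" if "x \<in> cball p r'" "t \<in> {s..<T}" for x t
        using bounds(2)[OF that] by simp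
      show "- u x s \<le> - u p s + L * norm (x - p)" if "x \<in> cball p r'" for x
        using start[OF that] by simp
      show "\<bar>- u x t\<bar> \<le> m" if "x \<in> cball p r'" "t \<in> {s..<T}" for x t
        using bounds(1)[OF that] by simp
    qed (use \<epsilon> m t in auto)
    moreover have "\<kappa> * (t - s) \<le> \<kappa> * (T - s)"
      using t \<open>0 < \<kappa>\<close> by (intro mult_left_mono) auto
    ultimately show ?thesis using s(3) by linarith
  qed
  then show "\<exists>s<T. \<forall>t\<in>{s..<T}. \<bar>u p t - u p s\<bar> \<le> \<epsilon>"
    using s(2) by blast
qed

section \<open>Classical solutions with the type I rate\<close>

lemma has_second_deriv_imp_deriv2:
  assumes "has_second_deriv \<phi> D"
  shows "(deriv ^^ 2) \<phi> 0 = D"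
proof -
  obtain g where
    g: "\<forall>\<^sub>F s in nhds 0. (\<phi> has_real_derivative g s) (at s)" "(g has_real_derivative D) (at 0)"
    using assms unfolding has_second_deriv_def by blast
  have "\<forall>\<^sub>F s in nhds 0. deriv \<phi> s = g s"
    using g(1) by eventually_elim (rule DERIV_imp_deriv)
  then have "deriv (deriv \<phi>) 0 = deriv g 0"
    by (rule deriv_cong_ev) simp
  also have "\<dots> = D" by (rule DERIV_imp_deriv[OF g(2)])
  finally show ?thesis by (simp add: numeral_2_eq_2)
qed

lemma C2_imp_has_laplacian:
  fixes f :: "'a::euclidean_space \<Rightarrow> real" and H :: "'a \<Rightarrow>\<^sub>L 'a"
  assumes S: "open S" "x \<in> S"
    and g: "\<And>z. z \<in> S \<Longrightarrow> GDERIV f z :> g z" and H: "(g has_derivative blinfun_apply H) (at x)"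
  shows "has_laplacian f (laplacian f x) x"
proof -
  have dir: "has_second_deriv (\<lambda>s. f (x + s *\<^sub>R b)) (blinfun_apply H b \<bullet> b)" for b
  proof (rule has_second_derivI[where g = "\<lambda>s. g (x + s *\<^sub>R b) \<bullet> b"])
    have line: "((\<lambda>s. x + s *\<^sub>R b) has_derivative (\<lambda>s. s *\<^sub>R b)) (at s)" for s
      by (auto intro!: derivative_eq_intros)
    have "open ((\<lambda>s. x + s *\<^sub>R b) -` S)"
      by (rule open_vimage[OF S(1)]) (intro continuous_intros)
    then have "\<forall>\<^sub>F s in nhds 0. s \<in> (\<lambda>s. x + s *\<^sub>R b) -` S"
      using S(2) by (intro eventually_nhds_in_open) auto
    then show "\<forall>\<^sub>F s in nhds 0. ((\<lambda>s. f (x + s *\<^sub>R b)) has_real_derivative g (x + s *\<^sub>R b) \<bullet> b) (at s)"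
    proof eventually_elim
      case (elim s)
      then have "(f has_derivative (\<lambda>h. h \<bullet> g (x + s *\<^sub>R b))) (at (x + s *\<^sub>R b))"
        using g unfolding gderiv_def by simp
      from has_derivative_compose[OF line this] show ?case
        unfolding has_field_derivative_def by (simp add: inner_commute[of b] mult_commute_abs)
    qed
    have "(g has_derivative blinfun_apply H) (at (x + 0 *\<^sub>R b))"
      using H by simp
    from has_derivative_compose[OF line this]
    have "((\<lambda>s. g (x + s *\<^sub>R b)) has_derivative (\<lambda>s. blinfun_apply H (s *\<^sub>R b))) (at 0)" .
    from has_derivative_inner_left[OF this, of b]
    show "((\<lambda>s. g (x + s *\<^sub>R b) \<bullet> b) has_real_derivative blinfun_apply H b \<bullet> b) (at 0)"
      unfolding has_field_derivative_def by (simp add: blinfun.scaleR_right mult_commute_abs)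
  qed
  then show ?thesis
    unfolding has_laplacian_def laplacian_def
    by (intro exI[of _ "\<lambda>b. blinfun_apply H b \<bullet> b"]) (simp add: has_second_deriv_imp_deriv2[OF dir])
qed

lemma classical_solution_solves_heat:
  fixes u :: "'a::euclidean_space \<Rightarrow> real \<Rightarrow> real"
  assumes sol: "classical_solution \<Omega> u0 T u" and \<Omega>: "open \<Omega>"
  shows "solves_heat (\<Omega> \<times> {0<..<T}) u (\<lambda>x t. exp (u x t))"
  unfolding solves_heat_def
proof (intro conjI ballI; clarify?)
  have "\<Omega> \<times> {0<..<T} \<subseteq> closure \<Omega> \<times> {0..<T} - frontier \<Omega> \<times> {0}"
    using closure_subset by force
  then show "continuous_on (\<Omega> \<times> {0<..<T}) (\<lambda>(x, t). u x t)"
    using sol unfolding classical_solution_def by (blast intro: continuous_on_subset)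
  obtain g H v where C21: "\<And>x t. x \<in> \<Omega> \<Longrightarrow> t \<in> {0<..<T} \<Longrightarrow> GDERIV (\<lambda>z. u z t) x :> g (x, t) \<and>
      ((\<lambda>z. g (z, t)) has_derivative blinfun_apply (H (x, t))) (at x) \<and>
      (u x has_real_derivative v (x, t)) (at t)"
    using sol unfolding classical_solution_def C21_on_def by fast
  fix x t assume xt: "x \<in> \<Omega>" "t \<in> {0<..<T}"
  have "has_laplacian (\<lambda>z. u z t) (laplacian (\<lambda>z. u z t) x) x"
    by (rule C2_imp_has_laplacian[OF \<Omega> xt(1), of _ "\<lambda>z. g (z, t)" "H (x, t)"]) (use C21 xt in auto)
  moreover have "(u x has_real_derivative laplacian (\<lambda>z. u z t) x + exp (u x t)) (at t)"
  proof -
    have der: "(u x has_real_derivative v (x, t)) (at t)" using C21 xt by blast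
    have "deriv (u x) t = laplacian (\<lambda>z. u z t) x + exp (u x t)"
      using sol xt unfolding classical_solution_def by blast
    with der show ?thesis by (metis DERIV_imp_deriv)
  qed
  ultimately show "\<exists>L. (u x has_real_derivative L + exp (u x t)) (at t) \<and>
      has_laplacian (\<lambda>z. u z t) L x"
    by blast
qed

lemma type_I_rate_imp_log_bound:
  assumes "type_I_rate \<Omega> u T"
  obtains M where "1 \<le> M" "\<And>x t. x \<in> \<Omega> \<Longrightarrow> t \<in> {0..<T} \<Longrightarrow> \<bar>u x t\<bar> \<le> ln M - ln (T - t)"
proof -
  obtain C2 where C2: "\<And>t. t \<in> {0..<T} \<Longrightarrow>
      ereal (ln (T - t)) + sup_norm \<Omega> (\<lambda>x. u x t) \<le> ereal C2"
    using assms unfolding type_I_rate_def by blast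
  show ?thesis
  proof (rule that[of "exp (max 0 C2)"])
    fix x t assume xt: "x \<in> \<Omega>" "t \<in> {0..<T}"
    have "ereal \<bar>u x t\<bar> \<le> sup_norm \<Omega> (\<lambda>x. u x t)"
      unfolding sup_norm_def using xt(1) by (rule SUP_upper)
    then have "ereal (ln (T - t)) + ereal \<bar>u x t\<bar> \<le> ereal (ln (T - t)) + sup_norm \<Omega> (\<lambda>x. u x t)"
      by (rule add_left_mono)
    also have "\<dots> \<le> ereal C2" by (rule C2[OF xt(2)])
    finally show "\<bar>u x t\<bar> \<le> ln (exp (max 0 C2)) - ln (T - t)" by simp
  qed simp
qed

section \<open>The final profile\<close>

text \<open>The data of the problem in the form in which the comparison arguments use them: the equation,
  the type I rate as a pointwise bound, and the convergence to a profile with logarithmic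
  behaviour at infinity.\<close>
locale type_I_profile =
  fixes u :: "'a::euclidean_space \<Rightarrow> real \<Rightarrow> real" and \<phi> :: "'a \<Rightarrow> real" and R T M C :: real
  assumes R: "0 < R" and T: "0 < T" and M: "1 \<le> M"
    and heat: "solves_heat (ball 0 R \<times> {0<..<T}) u (\<lambda>x t. exp (u x t))"
    and log_bound: "\<And>x t. x \<in> ball 0 R \<Longrightarrow> t \<in> {0<..<T} \<Longrightarrow> \<bar>u x t\<bar> \<le> ln M - ln (T - t)"
    and convergence: "\<And>K. compact K \<Longrightarrow>
      uniform_limit K (\<lambda>t y. ln (T - t) + u (sqrt (T - t) *\<^sub>R y) t) \<phi> (at_left T)"
    and \<phi>_infinity: "((\<lambda>y. \<phi> y + 2 * ln (norm y)) \<longlongrightarrow> C) at_infinity"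
begin

text \<open>For \<open>y = x / \<surd>(T - t)\<close> the logarithmic corrections cancel:
  \<open>ln (T - t) + u x t + 2 ln \<bar>y\<bar> = u x t + 2 ln \<bar>x\<bar>\<close>. The inner radius \<open>K0\<close> depends on \<open>\<epsilon>\<close> only,
  whereas \<open>\<delta>\<close> depends on the outer radius too, since the convergence is uniform on compact sets
  only.\<close>
lemma profile_on_shells:
  assumes \<epsilon>: "0 < \<epsilon>"
  obtains K0 where "0 < K0" "\<And>K. \<exists>\<delta>>0. \<forall>x t. T - \<delta> < t \<and> t < T \<and>
    K0 * sqrt (T - t) \<le> norm x \<and> norm x \<le> K * sqrt (T - t) \<longrightarrow> \<bar>u x t + 2 * ln (norm x) - C\<bar> \<le> \<epsilon>"
proof -
  have "\<forall>\<^sub>F y in at_infinity. \<bar>\<phi> y + 2 * ln (norm y) - C\<bar> < \<epsilon> / 2"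
    using tendstoD[OF \<phi>_infinity, of "\<epsilon> / 2"] \<epsilon> unfolding dist_real_def by simp
  then obtain b where b: "\<And>y. b \<le> norm y \<Longrightarrow> \<bar>\<phi> y + 2 * ln (norm y) - C\<bar> < \<epsilon> / 2"
    unfolding eventually_at_infinity by blast
  show ?thesis
  proof (rule that[of "max b 1"])
    fix K
    have "\<forall>\<^sub>F t in at_left T. \<forall>y\<in>cball 0 K. \<bar>ln (T - t) + u (sqrt (T - t) *\<^sub>R y) t - \<phi> y\<bar> < \<epsilon> / 2"
      using uniform_limitD[OF convergence[OF compact_cball], of "\<epsilon> / 2"] \<epsilon>
      unfolding dist_real_def by simp
    then obtain t0 where t0: "t0 < T" "\<And>t y. t0 < t \<Longrightarrow> t < T \<Longrightarrow> norm y \<le> K \<Longrightarrow>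
        \<bar>ln (T - t) + u (sqrt (T - t) *\<^sub>R y) t - \<phi> y\<bar> < \<epsilon> / 2"
      using eventually_at_left[of "T - 1" T] by auto
    have "\<bar>u x t + 2 * ln (norm x) - C\<bar> \<le> \<epsilon>"
      if t: "T - (T - t0) < t" "t < T"
        and x: "max b 1 * sqrt (T - t) \<le> norm x" "norm x \<le> K * sqrt (T - t)" for x t
    proof -
      define s where "s = sqrt (T - t)"
      define y where "y = x /\<^sub>R s"
      have s: "0 < s" using t unfolding s_def by simp
      have x_y: "x = s *\<^sub>R y" "norm y = norm x / s"
        using s unfolding y_def by (auto simp: divide_inverse)
      have y: "max b 1 \<le> norm y" "norm y \<le> K"
        using x s unfolding x_y(2) s_def[symmetric]
        by (simp_all only: pos_le_divide_eq[OF s] pos_divide_le_eq[OF s])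
      have y_pos: "0 < norm y" using y(1) by linarith
      have "ln (norm x) = ln s + ln (norm y)"
        using s y_pos unfolding x_y(1) by (simp add: ln_mult)
      moreover have "ln s = ln (T - t) / 2"
        unfolding s_def using t by (simp add: ln_sqrt)
      moreover have "\<bar>ln (T - t) + u x t - \<phi> y\<bar> < \<epsilon> / 2"
        using t0(2)[of t y] t y unfolding x_y(1) s_def by simp
      moreover have "\<bar>\<phi> y + 2 * ln (norm y) - C\<bar> < \<epsilon> / 2"
        using b y by simp
      ultimately show ?thesis by linarith
    qed
    then show "\<exists>\<delta>>0. \<forall>x t. T - \<delta> < t \<and> t < T \<and> max b 1 * sqrt (T - t) \<le> norm x \<and>
        norm x \<le> K * sqrt (T - t) \<longrightarrow> \<bar>u x t + 2 * ln (norm x) - C\<bar> \<le> \<epsilon>"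
      using t0(1) by (intro exI[of _ "T - t0"]) auto
  qed simp
qed

text \<open>At time \<open>T - \<theta> \<bar>x\<bar>\<^sup>2\<close> the ball of radius \<open>\<bar>x\<bar> / 2\<close> about \<open>x\<close> lies in a shell on which the profile
  is known, so that \<open>type_I_local_upper_bound\<close> applies on the scale \<open>l = \<bar>x\<bar>\<close>, with the same
  \<open>\<theta>\<close> for all \<open>x\<close>.\<close>
lemma scale_invariant_upper_bound:
  obtains \<theta> c r where "0 < \<theta>" "0 < r"
    "\<And>x t. 0 < norm x \<Longrightarrow> norm x \<le> r \<Longrightarrow> T - \<theta> * (norm x)\<^sup>2 \<le> t \<Longrightarrow> t < T \<Longrightarrow>
      u x t \<le> c - 2 * ln (norm x)"
proof -
  obtain K0 where K0: "0 < K0" "\<And>K. \<exists>\<delta>>0. \<forall>x t. T - \<delta> < t \<and> t < T \<and>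
      K0 * sqrt (T - t) \<le> norm x \<and> norm x \<le> K * sqrt (T - t) \<longrightarrow> \<bar>u x t + 2 * ln (norm x) - C\<bar> \<le> 1"
    using profile_on_shells[of 1] by auto
  \<comment> \<open>\<open>2 ln 2\<close> accounts for the points of the ball with \<open>norm z\<close> close to \<open>norm x / 2\<close>.\<close>
  define c where "c = C + 1 + 2 * ln 2"
  \<comment> \<open>All requirements on \<open>\<theta>\<close> hold near \<open>0\<close>; the second one places the ball outside \<open>K0 \<surd>\<tau>\<close>.\<close>
  have "\<forall>\<^sub>F \<theta> in at_right (0::real). \<theta> < 1 / 16"
    by (rule order_tendstoD(2)[of _ 0]) (auto intro!: tendsto_eq_intros)
  moreover have "\<forall>\<^sub>F \<theta> in at_right (0::real). K0 * sqrt \<theta> < 1 / 2"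
    by (rule order_tendstoD(2)[of _ 0]) (auto intro!: tendsto_eq_intros)
  moreover have "\<forall>\<^sub>F \<theta> in at_right (0::real).
      16 * real DIM('a) * M * sqrt \<theta> + exp (c + 3 + 4 * M * ln 2) * \<theta> < 1"
    by (rule order_tendstoD(2)[of _ 0]) (auto intro!: tendsto_eq_intros)
  moreover have "\<forall>\<^sub>F \<theta> in at_right (0::real). ln \<theta> < c + 1 - 4 * ln 4 - ln M"
    using ln_at_0 unfolding filterlim_at_bot_dense by blast
  moreover have "\<forall>\<^sub>F \<theta> in at_right (0::real). 0 < \<theta>"
    by (simp add: eventually_at_right_less)
  ultimately have "\<forall>\<^sub>F \<theta> in at_right (0::real). \<theta> < 1 / 16 \<and> K0 * sqrt \<theta> < 1 / 2 \<and>
      16 * real DIM('a) * M * sqrt \<theta> + exp (c + 3 + 4 * M * ln 2) * \<theta> < 1 \<and>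
      ln \<theta> < c + 1 - 4 * ln 4 - ln M \<and> 0 < \<theta>"
    by (intro eventually_conj)
  then obtain \<theta> where \<theta>: "\<theta> < 1 / 16" "K0 * sqrt \<theta> < 1 / 2"
      "16 * real DIM('a) * M * sqrt \<theta> + exp (c + 3 + 4 * M * ln 2) * \<theta> < 1"
      "ln \<theta> < c + 1 - 4 * ln 4 - ln M" "0 < \<theta>"
    using eventually_happens'[OF trivial_limit_at_right_real] by blast
  \<comment> \<open>The ball reaches out to \<open>3 / 2 * norm x\<close>, where \<open>norm x = \<surd>(\<tau> / \<theta>)\<close>.\<close>
  define K where "K = 3 / (2 * sqrt \<theta>)"
  obtain \<delta> where \<delta>: "0 < \<delta>" "\<And>x t. T - \<delta> < t \<Longrightarrow> t < T \<Longrightarrow> K0 * sqrt (T - t) \<le> norm x \<Longrightarrow>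
      norm x \<le> K * sqrt (T - t) \<Longrightarrow> \<bar>u x t + 2 * ln (norm x) - C\<bar> \<le> 1"
    using K0(2)[of K] by blast
  define r where "r = min (R / 2) (min 1 (min \<delta> T / 2))"
  have r: "0 < r" "r \<le> R / 2" "r \<le> 1" "r < \<delta>" "r < T"
    using R T \<delta>(1) unfolding r_def by (auto simp: min_def)
  show ?thesis
  proof (rule that[OF \<theta>(5) r(1)])
    fix x :: 'a and t assume x: "0 < norm x" "norm x \<le> r" and t: "T - \<theta> * (norm x)\<^sup>2 \<le> t" "t < T"
    define l where "l = norm x"
    have l: "0 < l" "l \<le> r" "norm x = l" using x unfolding l_def by auto
    have "\<theta> * l\<^sup>2 \<le> 1 * l"
      unfolding power2_eq_square mult.assoc[symmetric]
      using l r \<theta>(1,5) mult_mono[of \<theta> 1 l 1] by (intro mult_right_mono) auto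
    then have small: "\<theta> * l\<^sup>2 < \<delta>" "\<theta> * l\<^sup>2 < T" using l r by auto
    have t0: "T - \<theta> * l\<^sup>2 < T" using l \<theta>(5) by simp
    have near: "l / 2 \<le> norm z" "norm z \<le> 3 / 2 * l" if "z \<in> cball x (l / 2)" for z
      using that l(3) norm_triangle_ineq2[of x z] norm_triangle_ineq2[of z x]
      by (auto simp: dist_norm norm_minus_commute)
    have ball: "z \<in> ball 0 R" if "z \<in> cball x (l / 2)" for z
      using near(2)[OF that] l r R by simp
    show "u x t \<le> (c + 2) - 2 * ln (norm x)"
      unfolding l(3)
    proof (rule type_I_local_upper_bound[where u = u and \<theta> = \<theta> and c = c, OF l(1) M])
      show "solves_heat (cball x (l / 2) \<times> {T - \<theta> * l\<^sup>2..<T}) u (\<lambda>x t. exp (u x t))"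
        by (rule solves_heat_subset[OF heat]) (use ball small in auto)
      show "u z s \<le> ln M - ln (T - s)" if "z \<in> cball x (l / 2)" "s \<in> {T - \<theta> * l\<^sup>2..<T}" for z s
        using log_bound[OF ball[OF that(1)], of s] that(2) small by auto
      show "u z (T - \<theta> * l\<^sup>2) \<le> c - 2 * ln l" if z: "z \<in> cball x (l / 2)" for z
      proof -
        have s: "sqrt (T - (T - \<theta> * l\<^sup>2)) = sqrt \<theta> * l"
          using l by (simp add: real_sqrt_mult)
        have "K0 * (sqrt \<theta> * l) \<le> 1 / 2 * l"
          unfolding mult.assoc[symmetric] using \<theta>(2) l by (intro mult_right_mono) auto
        moreover have "K * (sqrt \<theta> * l) = 3 / 2 * l"
          unfolding K_def using \<theta>(5) by simp
        ultimately have "\<bar>u z (T - \<theta> * l\<^sup>2) + 2 * ln (norm z) - C\<bar> \<le> 1"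
          using near[OF z] small t0 by (intro \<delta>(2)) (unfold s, linarith+)
        moreover have "ln l - ln 2 \<le> ln (norm z)"
          using ln_mono[OF near(1)[OF z]] l(1) by (simp add: ln_div)
        ultimately show ?thesis unfolding c_def by linarith
      qed
      show "0 < \<theta>" "\<theta> \<le> 1 / 16" "ln \<theta> < c + 1 - 4 * ln 4 - ln M"
        "16 * real DIM('a) * M * sqrt \<theta> + exp (c + 3 + 4 * M * ln 2) * \<theta> \<le> 1"
        using \<theta> by auto
      show "t \<in> {T - \<theta> * l\<^sup>2..<T}" using t l by simp
    qed
  qed
qed

text \<open>A bound for the outer boundary in \<open>paraboloid_exterior_upper_bound\<close>. It need not be uniform
  in \<open>r\<close>, so continuity at time \<open>T / 2\<close> is enough to start from.\<close>
lemma lower_bound_on_sphere: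
  assumes r: "0 < r" "r \<le> R / 2"
  obtains m where "\<And>x t. norm x = r \<Longrightarrow> T / 2 \<le> t \<Longrightarrow> t < T \<Longrightarrow> - u x t \<le> m"
proof -
  have near: "z \<in> cball 0 (3 / 2 * r)" if "z \<in> cball x (r / 2)" "norm x = r" for x z
    using that norm_triangle_ineq2[of z x] by (auto simp: dist_norm norm_minus_commute)
  have big: "cball 0 (3 / 2 * r) \<subseteq> ball (0::'a) R" using r R by auto
  have cont: "continuous_on (ball 0 R \<times> {0<..<T}) (\<lambda>(x, t). u x t)"
    using heat unfolding solves_heat_def by simp
  have "continuous_on (cball 0 (3 / 2 * r)) (\<lambda>x. (\<lambda>(x, t). u x t) (x, T / 2))"
    by (rule continuous_on_compose2[OF cont]) (use big T in \<open>auto intro!: continuous_intros\<close>)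
  then have "bounded ((\<lambda>x. u x (T / 2)) ` cball 0 (3 / 2 * r))"
    by (intro compact_imp_bounded compact_continuous_image) auto
  then obtain m where "\<forall>y\<in>(\<lambda>x. u x (T / 2)) ` cball 0 (3 / 2 * r). norm y \<le> m"
    unfolding bounded_iff by blast
  then have m: "\<bar>u x (T / 2)\<bar> \<le> m" if "x \<in> cball 0 (3 / 2 * r)" for x
    using that by simp
  define k where "k = (2 + (\<bar>ln M\<bar> + \<bar>m\<bar>) * sqrt (T - T / 2)) / (r / 2)\<^sup>2"
  show ?thesis
  proof (rule that)
    fix x :: 'a and t assume x: "norm x = r" and t: "T / 2 \<le> t" "t < T"
    have ball: "z \<in> ball 0 R" if "z \<in> cball x (r / 2)" for z
      using near[OF that x] big by blast
    show "- u x t \<le> m + 1 + 4 * real DIM('a) * k * sqrt (T - T / 2) + (T - T / 2)"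
    proof (rule log_bounded_subsolution_bounded[where r = "r / 2" and c = "ln M"
          and v = "\<lambda>x t. - u x t" and f = "\<lambda>x t. - exp (u x t)"])
      show "solves_heat (cball x (r / 2) \<times> {T / 2..<T}) (\<lambda>x t. - u x t) (\<lambda>x t. - exp (u x t))"
        by (rule solves_heat_minus[OF solves_heat_subset[OF heat]]) (use ball T in auto)
      show "- u z s \<le> ln M - ln (T - s)" if "z \<in> cball x (r / 2)" "s \<in> {T / 2..<T}" for z s
        using log_bound[OF ball[OF that(1)], of s] that(2) T by auto
      show "- u z (T / 2) \<le> m" if "z \<in> cball x (r / 2)" for z
        using m[OF near[OF that x]] by simp
      show "2 + (\<bar>ln M\<bar> + \<bar>m\<bar>) * sqrt (T - T / 2) \<le> k * (r / 2)\<^sup>2"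
        unfolding k_def using r by simp
    qed (use r T t in auto)
  qed
qed

text \<open>The order of choices matters: the source bound \<open>A0\<close> comes first, then \<open>K\<close> so large that the error
  \<open>A / K\<^sup>2\<close> is small, then \<open>r\<close> so small that \<open>u\<close> follows the profile on \<open>\<bar>x\<bar> = K \<surd>\<tau> \<le> r\<close>, and only
  then \<open>\<Lambda>\<close>.\<close>
lemma profile_estimate:
  assumes e: "0 < e"
  obtains K r \<Lambda> where "0 < K" "0 < r" "r < R" "r\<^sup>2 / K\<^sup>2 < T" "0 \<le> \<Lambda>"
    "\<And>x t. 0 < norm x \<Longrightarrow> norm x \<le> r \<Longrightarrow> T - (norm x)\<^sup>2 / K\<^sup>2 \<le> t \<Longrightarrow> t < T \<Longrightarrow>
      \<bar>u x t + 2 * ln (norm x) - C\<bar> \<le> e + \<Lambda> * (norm x)\<^sup>2"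
proof -
  obtain \<theta> c0 r0 where \<theta>: "0 < \<theta>" and r0: "0 < r0" and upper:
      "\<And>x t. 0 < norm x \<Longrightarrow> norm x \<le> r0 \<Longrightarrow> T - \<theta> * (norm x)\<^sup>2 \<le> t \<Longrightarrow> t < T \<Longrightarrow>
        u x t \<le> c0 - 2 * ln (norm x)"
    using that by (rule scale_invariant_upper_bound)
  define N A0 A where "N = real DIM('a)" and "A0 = exp c0" and "A = 2 * (A0 + 2 * N + 5)"
  have e4: "0 < e / 4" using e by simp
  obtain K0 where K0: "0 < K0" "\<And>K. \<exists>\<delta>>0. \<forall>x t. T - \<delta> < t \<and> t < T \<and>
      K0 * sqrt (T - t) \<le> norm x \<and> norm x \<le> K * sqrt (T - t) \<longrightarrow> \<bar>u x t + 2 * ln (norm x) - C\<bar> \<le> e / 4"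
    using that by (rule profile_on_shells[OF e4])
  define K where "K = 1 + K0 + 4 * N + 1 / \<theta> + 2 * A / e"
  have A: "0 < A" unfolding A_def A0_def N_def by (intro mult_pos_pos add_pos_nonneg) auto
  have terms: "0 \<le> 4 * N" "0 < 1 / \<theta>" "0 < 2 * A / e"
    using A \<theta> e unfolding N_def by auto
  then have K1: "1 \<le> K" "K0 \<le> K" "4 * N \<le> K" "1 / \<theta> \<le> K" "2 * A / e \<le> K"
    unfolding K_def using K0(1) by linarith+
  have "K * 1 \<le> K * K" using K1(1) by (intro mult_left_mono) auto
  then have KK: "K \<le> K\<^sup>2" by (simp add: power2_eq_square)
  have K2: "1 \<le> K\<^sup>2" "4 * N \<le> K\<^sup>2" "1 / \<theta> \<le> K\<^sup>2" "2 * A / e \<le> K\<^sup>2"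
    using KK K1 by linarith+
  have AK: "A / K\<^sup>2 \<le> e / 2" and \<theta>K: "1 / K\<^sup>2 \<le> \<theta>"
    using K2 e \<theta> less_le_trans[OF zero_less_one K2(1)] by (simp_all add: field_simps)
  obtain \<delta> where \<delta>: "0 < \<delta>" "\<And>x t. T - \<delta> < t \<Longrightarrow> t < T \<Longrightarrow> K0 * sqrt (T - t) \<le> norm x \<Longrightarrow>
      norm x \<le> K * sqrt (T - t) \<Longrightarrow> \<bar>u x t + 2 * ln (norm x) - C\<bar> \<le> e / 4"
    using K0(2)[of K] by blast
  define r where "r = Min {r0, R / 2, 1, \<delta> / 2, T / 4}"
  have "0 < r"
    unfolding r_def using r0 R T \<delta>(1) by (subst Min_gr_iff) auto
  moreover have "r \<le> r0" "r \<le> R / 2" "r \<le> 1" "r \<le> \<delta> / 2" "r \<le> T / 4"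
    unfolding r_def by (rule Min_le; simp)+
  ultimately have r: "0 < r" "r \<le> r0" "r \<le> R / 2" "r \<le> 1" "r < \<delta>" "r < T / 2"
    using T \<delta>(1) by linarith+
  have r2: "r\<^sup>2 / K\<^sup>2 \<le> r"
  proof -
    have "r\<^sup>2 / K\<^sup>2 \<le> r\<^sup>2 / 1" using K2 r by (intro divide_left_mono) auto
    also have "\<dots> \<le> r" using r by (simp add: power2_eq_square mult_left_le)
    finally show ?thesis .
  qed
  obtain m where m: "\<And>x t. norm x = r \<Longrightarrow> T / 2 \<le> t \<Longrightarrow> t < T \<Longrightarrow> - u x t \<le> m"
    using that by (rule lower_bound_on_sphere[OF r(1,3)])
  let ?D = "paraboloid_exterior T K r :: ('a \<times> real) set"
  have D: "0 < norm x" "norm x \<le> r" "t < T" "T - \<theta> * (norm x)\<^sup>2 \<le> t" "T - \<delta> < t" "T / 2 < t"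
    if "(x, t) \<in> ?D" for x t
  proof -
    show t: "t < T" and x: "norm x \<le> r"
      using that unfolding paraboloid_exterior_def by auto
    have K_le: "K\<^sup>2 * (T - t) \<le> (norm x)\<^sup>2"
      using that unfolding paraboloid_exterior_def by auto
    moreover have "0 < K\<^sup>2 * (T - t)" using t K1(1) by simp
    ultimately have "0 < (norm x)\<^sup>2" by linarith
    then show "0 < norm x" by simp
    have "T - t \<le> (norm x)\<^sup>2 / K\<^sup>2"
      using K_le K1(1) by (simp add: field_simps)
    moreover have "(norm x)\<^sup>2 / K\<^sup>2 \<le> \<theta> * (norm x)\<^sup>2"
      using mult_right_mono[OF \<theta>K, of "(norm x)\<^sup>2"] by simp
    moreover have "(norm x)\<^sup>2 / K\<^sup>2 \<le> r\<^sup>2 / K\<^sup>2"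
      using x by (intro divide_right_mono power_mono) auto
    ultimately show "T - \<theta> * (norm x)\<^sup>2 \<le> t" "T - \<delta> < t" "T / 2 < t"
      using r2 r by linarith+
  qed
  have heat_D: "solves_heat ?D u (\<lambda>x t. exp (u x t))"
  proof (rule solves_heat_subset[OF heat], clarify)
    fix x t assume "(x, t) \<in> ?D"
    from D[OF this] show "x \<in> ball 0 R \<and> t \<in> {0<..<T}" using r R T by auto
  qed
  have inner: "\<bar>u x t + 2 * ln (norm x) - C\<bar> \<le> e / 4"
    if xt: "(x, t) \<in> ?D" and eq: "(norm x)\<^sup>2 = K\<^sup>2 * (T - t)" for x t
  proof -
    have "norm x = sqrt (K\<^sup>2 * (T - t))"
      unfolding eq[symmetric] by simp
    then have "norm x = K * sqrt (T - t)"
      using K1(1) by (simp add: real_sqrt_mult)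
    moreover have "K0 * sqrt (T - t) \<le> K * sqrt (T - t)"
      using K1(2) D[OF xt] by (intro mult_right_mono) auto
    ultimately show ?thesis
      using D[OF xt] by (intro \<delta>(2)) auto
  qed
  have source: "exp (u x t) \<le> A0 / (norm x)\<^sup>2" if xt: "(x, t) \<in> ?D" for x t
  proof -
    have "exp (u x t) \<le> exp (c0 - 2 * ln (norm x))"
      using upper[of x t] D[OF xt] r by simp
    also have "\<dots> = A0 / (norm x)\<^sup>2"
      using D[OF xt] by (simp add: A0_def exp_diff exp_double[of "ln (norm x)"])
    finally show ?thesis .
  qed
  have A0: "0 \<le> A0" unfolding A0_def by simp
  have "\<exists>\<Lambda>. \<forall>(x, t)\<in>?D. u x t \<le>
      C + 2 * (e / 4) - 2 * 1 * ln (norm x) + 2 * (A0 + 2 * real DIM('a) + 5) / K\<^sup>2 + \<Lambda> * (norm x)\<^sup>2"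
  proof (rule paraboloid_exterior_upper_bound[OF r(1) _ _ _ _ heat_D source A0])
    show "u x t \<le> C + e / 4 - 2 * 1 * ln (norm x)"
      if "(x, t) \<in> ?D" "(norm x)\<^sup>2 = K\<^sup>2 * (T - t)" for x t
      using inner[OF that] by linarith
    show "u x t \<le> c0 - 2 * ln r" if "(x, t) \<in> ?D" "norm x = r" for x t
      using upper[of x t] D[OF that(1)] that(2) r by simp
  qed (use K1(1) K2(2) e N_def in auto)
  then obtain \<Lambda>1 where bound1: "\<forall>(x, t)\<in>?D. u x t \<le>
      C + 2 * (e / 4) - 2 * 1 * ln (norm x) + 2 * (A0 + 2 * real DIM('a) + 5) / K\<^sup>2 + \<Lambda>1 * (norm x)\<^sup>2"
    ..
  have \<Lambda>1: "u x t \<le> C + e / 2 - 2 * ln (norm x) + A / K\<^sup>2 + \<Lambda>1 * (norm x)\<^sup>2"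
    if "(x, t) \<in> ?D" for x t
    using bspec[OF bound1 that] by (simp add: A_def N_def)
  have "\<exists>\<Lambda>. \<forall>(x, t)\<in>?D. - u x t \<le>
      - C + 2 * (e / 4) - 2 * (- 1) * ln (norm x) + 2 * (A0 + 2 * real DIM('a) + 5) / K\<^sup>2 + \<Lambda> * (norm x)\<^sup>2"
  proof (rule paraboloid_exterior_upper_bound[OF r(1) _ _ _ _ solves_heat_minus[OF heat_D] _ A0])
    show "- exp (u x t) \<le> A0 / (norm x)\<^sup>2" if "(x, t) \<in> ?D" for x t
      using A0 by (simp add: order_trans[of _ 0])
    show "- u x t \<le> - C + e / 4 - 2 * (- 1) * ln (norm x)"
      if "(x, t) \<in> ?D" "(norm x)\<^sup>2 = K\<^sup>2 * (T - t)" for x t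
      using inner[OF that] by linarith
    show "- u x t \<le> m" if "(x, t) \<in> ?D" "norm x = r" for x t
      using m[OF that(2)] D[OF that(1)] by simp
  qed (use K1(1) K2(2) e N_def in auto)
  then obtain \<Lambda>2 where bound2: "\<forall>(x, t)\<in>?D. - u x t \<le>
      - C + 2 * (e / 4) - 2 * (- 1) * ln (norm x) + 2 * (A0 + 2 * real DIM('a) + 5) / K\<^sup>2 + \<Lambda>2 * (norm x)\<^sup>2"
    ..
  have \<Lambda>2: "- u x t \<le> - C + e / 2 + 2 * ln (norm x) + A / K\<^sup>2 + \<Lambda>2 * (norm x)\<^sup>2"
    if "(x, t) \<in> ?D" for x t
    using bspec[OF bound2 that] by (simp add: A_def N_def)
  show ?thesis
  proof (rule that[of K r "max 0 (max \<Lambda>1 \<Lambda>2)"])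
    fix x :: 'a and t assume x: "0 < norm x" "norm x \<le> r" and t: "T - (norm x)\<^sup>2 / K\<^sup>2 \<le> t" "t < T"
    have "K\<^sup>2 * (T - t) \<le> (norm x)\<^sup>2"
      using t K1(1) by (simp add: field_simps)
    then have xt: "(x, t) \<in> ?D"
      using x t unfolding paraboloid_exterior_def by simp
    have "\<Lambda>1 * (norm x)\<^sup>2 \<le> max 0 (max \<Lambda>1 \<Lambda>2) * (norm x)\<^sup>2"
      "\<Lambda>2 * (norm x)\<^sup>2 \<le> max 0 (max \<Lambda>1 \<Lambda>2) * (norm x)\<^sup>2"
      by (intro mult_right_mono; simp)+
    then show "\<bar>u x t + 2 * ln (norm x) - C\<bar> \<le> e + max 0 (max \<Lambda>1 \<Lambda>2) * (norm x)\<^sup>2"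
      using \<Lambda>1[OF xt] \<Lambda>2[OF xt] AK by linarith
  qed (use K1(1) r r2 R T in auto)
qed

text \<open>On the ball of radius \<open>\<bar>p\<bar> / 2\<close> about \<open>p\<close>, the estimate with error \<open>1\<close> bounds \<open>u\<close> and hence also
  the source, from some time before \<open>T\<close> on.\<close>
lemma final_profile_exists:
  obtains r where "0 < r" "\<And>x. 0 < norm x \<Longrightarrow> norm x < r \<Longrightarrow> \<exists>l. (u x \<longlongrightarrow> l) (at_left T)"
proof -
  obtain K r \<Lambda> where K: "0 < K" and r: "0 < r" "r < R" and rK: "r\<^sup>2 / K\<^sup>2 < T" and \<Lambda>: "0 \<le> \<Lambda>" and est:
    "\<And>x t. 0 < norm x \<Longrightarrow> norm x \<le> r \<Longrightarrow> T - (norm x)\<^sup>2 / K\<^sup>2 \<le> t \<Longrightarrow> t < T \<Longrightarrow>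
      \<bar>u x t + 2 * ln (norm x) - C\<bar> \<le> 1 + \<Lambda> * (norm x)\<^sup>2"
    using that by (rule profile_estimate[OF zero_less_one])
  show ?thesis
  proof (rule that[of "r / 2"])
    fix p :: 'a assume p: "0 < norm p" "norm p < r / 2"
    define l where "l = norm p"
    have l: "0 < l" "l < r / 2" "norm p = l" using p unfolding l_def by auto
    define m where "m = 1 + \<Lambda> * r\<^sup>2 + 2 * (\<bar>ln (l / 2)\<bar> + \<bar>ln r\<bar>) + \<bar>C\<bar>"
    define t0 where "t0 = T - (l / 2)\<^sup>2 / K\<^sup>2"
    have near: "l / 2 \<le> norm x" "norm x \<le> r" if "x \<in> cball p (2 * (l / 4))" for x
      using that l norm_triangle_ineq2[of p x] norm_triangle_ineq2[of x p]
      by (auto simp: dist_norm norm_minus_commute)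
    have "(l / 2)\<^sup>2 / K\<^sup>2 \<le> r\<^sup>2 / K\<^sup>2"
      using l by (intro divide_right_mono power_mono) auto
    then have t0: "0 < t0" "t0 < T"
      using rK l K unfolding t0_def by auto
    have bound: "\<bar>u x t\<bar> \<le> m" if x: "x \<in> cball p (2 * (l / 4))" and t: "t \<in> {t0..<T}" for x t
    proof -
      have "(l / 2)\<^sup>2 / K\<^sup>2 \<le> (norm x)\<^sup>2 / K\<^sup>2"
        using near[OF x] l by (intro divide_right_mono power_mono) auto
      then have "\<bar>u x t + 2 * ln (norm x) - C\<bar> \<le> 1 + \<Lambda> * (norm x)\<^sup>2"
        using near[OF x] l t unfolding t0_def by (intro est) auto
      moreover have "\<Lambda> * (norm x)\<^sup>2 \<le> \<Lambda> * r\<^sup>2"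
        using near[OF x] \<Lambda> by (intro mult_left_mono power_mono) auto
      moreover have "\<bar>ln (norm x)\<bar> \<le> \<bar>ln (l / 2)\<bar> + \<bar>ln r\<bar>"
      proof -
        have "ln (l / 2) \<le> ln (norm x)" "ln (norm x) \<le> ln r"
          using near[OF x] l r by (auto intro!: ln_mono)
        then show ?thesis
          using abs_ge_minus_self[of "ln (l / 2)"] abs_ge_self[of "ln r"]
          by (intro abs_leI) (simp_all add: add_increasing add_increasing2)
      qed
      moreover have "\<bar>a\<bar> \<le> d + 2 * c + \<bar>C\<bar>" if "\<bar>a + 2 * b - C\<bar> \<le> d" "\<bar>b\<bar> \<le> c" for a b c d
        using that by linarith
      ultimately show ?thesis unfolding m_def by (meson add_left_mono order_trans)
    qed
    show "\<exists>l. (u p \<longlongrightarrow> l) (at_left T)"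
    proof (rule bounded_heat_solution_has_limit[where f = "\<lambda>x t. exp (u x t)"])
      show "solves_heat (cball p (2 * (l / 4)) \<times> {t0..<T}) u (\<lambda>x t. exp (u x t))"
      proof (rule solves_heat_subset[OF heat], clarify)
        fix x t assume "x \<in> cball p (2 * (l / 4))" "t \<in> {t0..<T}"
        then show "x \<in> ball 0 R \<and> t \<in> {0<..<T}" using near(2)[of x] t0 r by auto
      qed
      show "\<bar>exp (u x t)\<bar> \<le> exp m" if "x \<in> cball p (2 * (l / 4))" "t \<in> {t0..<T}" for x t
        using bound[OF that] by simp
    qed (use bound l t0 in auto)
  qed (use r in simp)
qed

lemma final_profile_asymptotics:
  "((\<lambda>x. \<bar>final_profile u T x + 2 * ln (norm x) - C\<bar>) \<longlongrightarrow> 0) (at 0)"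
  unfolding tendsto_iff
proof (intro allI impI)
  fix e :: real assume e: "0 < e"
  obtain r1 where r1: "0 < r1" "\<And>x. 0 < norm x \<Longrightarrow> norm x < r1 \<Longrightarrow> \<exists>l. (u x \<longlongrightarrow> l) (at_left T)"
    using that by (rule final_profile_exists)
  have e3: "0 < e / 3" using e by simp
  obtain K r \<Lambda> where K: "0 < K" and r: "0 < r" and "r < R" "r\<^sup>2 / K\<^sup>2 < T" "0 \<le> \<Lambda>" and est:
    "\<And>x t. 0 < norm x \<Longrightarrow> norm x \<le> r \<Longrightarrow> T - (norm x)\<^sup>2 / K\<^sup>2 \<le> t \<Longrightarrow> t < T \<Longrightarrow>
      \<bar>u x t + 2 * ln (norm x) - C\<bar> \<le> e / 3 + \<Lambda> * (norm x)\<^sup>2"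
    using that by (rule profile_estimate[OF e3])
  have "((\<lambda>x::'a. \<Lambda> * (norm x)\<^sup>2) \<longlongrightarrow> 0) (at 0)"
    by (auto intro!: tendsto_eq_intros)
  then have "\<forall>\<^sub>F x::'a in at 0. \<Lambda> * (norm x)\<^sup>2 < e / 3"
    by (rule order_tendstoD(2)) (use e in simp)
  moreover have "\<forall>\<^sub>F x::'a in at 0. x \<noteq> 0 \<and> norm x < min r r1"
    unfolding eventually_at using r r1(1) by (intro exI[of _ "min r r1"]) auto
  ultimately show "\<forall>\<^sub>F x in at 0. dist \<bar>final_profile u T x + 2 * ln (norm x) - C\<bar> 0 < e"
  proof eventually_elim
    case (elim x)
    then have x: "0 < norm x" "norm x \<le> r" "norm x < r1" by auto
    obtain l where l: "(u x \<longlongrightarrow> l) (at_left T)" using r1(2)[OF x(1,3)] by blast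
    then have fp: "final_profile u T x = l"
      unfolding final_profile_def by (intro tendsto_Lim) auto
    have "((\<lambda>t. \<bar>u x t + 2 * ln (norm x) - C\<bar>) \<longlongrightarrow> \<bar>l + 2 * ln (norm x) - C\<bar>) (at_left T)"
      by (intro tendsto_intros l)
    moreover have "\<forall>\<^sub>F t in at_left T. \<bar>u x t + 2 * ln (norm x) - C\<bar> \<le> e / 3 + \<Lambda> * (norm x)\<^sup>2"
    proof -
      have "T - (norm x)\<^sup>2 / K\<^sup>2 < T" using x K by simp
      then have "\<forall>\<^sub>F t in at_left T. t \<in> {T - (norm x)\<^sup>2 / K\<^sup>2<..<T}"
        by (rule eventually_at_left_real)
      then show ?thesis
        by eventually_elim (use x in \<open>auto intro!: est\<close>)
    qed
    ultimately have "\<bar>l + 2 * ln (norm x) - C\<bar> \<le> e / 3 + \<Lambda> * (norm x)\<^sup>2"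
      by (rule tendsto_upperbound) simp
    then show ?case
      using elim e unfolding fp dist_real_def by simp
  qed
qed

end

theorem theorem3:
  fixes u :: "real ^ 'n \<Rightarrow> real \<Rightarrow> real"
    and u0 :: "real ^ 'n \<Rightarrow> real"
    and \<phi> :: "real ^ 'n \<Rightarrow> real"
    and R T \<alpha> C\<^sub>\<alpha> :: real
    and \<Omega> :: "(real ^ 'n) set"
  assumes dim: "3 \<le> CARD('n)" "CARD('n) \<le> 9"
    and domain: "0 < R" "\<Omega> = ball 0 R"
    and initial: "C1_closure \<Omega> u0" "\<And>x. x \<in> \<Omega> \<Longrightarrow> 0 \<le> u0 x"
    and solution: "classical_solution \<Omega> u0 T u"
    and blow_up: "type_I_blow_up_at \<Omega> u 0 T"
    and convergence: "\<And>K. compact K \<Longrightarrow>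
      uniform_limit K (\<lambda>t y. ln (T - t) + u (sqrt (T - t) *\<^sub>R y) t) \<phi> (at_left T)"
    and \<phi>_regular: "C2_on (- {0}) \<phi>"
    and \<phi>_equation: "\<And>y. 0 < norm y \<Longrightarrow>
      laplacian \<phi> y - (y /\<^sub>R 2) \<bullet> gradient \<phi> y + exp (\<phi> y) - 1 = 0"
    and \<phi>_zero: "0 < \<alpha>" "\<phi> 0 = \<alpha>" "GDERIV \<phi> 0 :> 0"
    and \<phi>_infinity: "((\<lambda>y. \<phi> y + 2 * ln (norm y)) \<longlongrightarrow> C\<^sub>\<alpha>) at_infinity"
  shows "(\<exists>\<epsilon>>0. \<forall>x. 0 < norm x \<and> norm x < \<epsilon> \<longrightarrow>
            (\<exists>l. (u x \<longlongrightarrow> l) (at_left T))) \<and>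
         ((\<lambda>x. \<bar>final_profile u T x + 2 * ln (norm x) - C\<^sub>\<alpha>\<bar>) \<longlongrightarrow> 0) (at 0)"
proof -
  obtain M where M: "1 \<le> M"
      "\<And>x t. x \<in> \<Omega> \<Longrightarrow> t \<in> {0..<T} \<Longrightarrow> \<bar>u x t\<bar> \<le> ln M - ln (T - t)"
    using blow_up type_I_rate_imp_log_bound unfolding type_I_blow_up_at_def by blast
  interpret type_I_profile u \<phi> R T M C\<^sub>\<alpha>
  proof
    show "0 < T"
      using blow_up unfolding type_I_blow_up_at_def blows_up_at_def by blast
    show "solves_heat (ball 0 R \<times> {0<..<T}) u (\<lambda>x t. exp (u x t))"
      using classical_solution_solves_heat[OF solution] domain(2) by simp
    show "\<bar>u x t\<bar> \<le> ln M - ln (T - t)" if "x \<in> ball 0 R" "t \<in> {0<..<T}" for x t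
      using M(2)[of x t] that domain(2) by simp
  qed (use domain(1) M(1) convergence \<phi>_infinity in auto)
  obtain r where "0 < r" "\<And>x. 0 < norm x \<Longrightarrow> norm x < r \<Longrightarrow> \<exists>l. (u x \<longlongrightarrow> l) (at_left T)"
    using that by (rule final_profile_exists)
  then show ?thesis
    using final_profile_asymptotics by blast
qed

end
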